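(* Let $f$ be a positive, finite, measurable function on $[0,1]$, let $$F(x):=1-\int_0^1 e^{-x f(y)}\,dy,\qquad x\ge 0,$$ and let $\mu$ be the permuton which is the law of $\big(U,F(E/f(U))\big)$, where $U$ is uniform on $[0,1]$ and $E$ is an independent exponential random variable of parameter $1$. Then: (1) The permuton $\mu$ is uniquely determined by its pattern densities $\widetilde{\mathrm{occ}}(\pi,\mu):=\mathbb P\big(\mathrm{Perm}(\mu,k)=\pi\big)$, $k\ge 1$, $\pi\in\mathcal S_k$, and these satisfy, for all $k\ge1$ and $\pi\in\mathcal S_k$, $$\widetilde{\mathrm{occ}}(\pi,\mu)=\mathbb E\Big[\mathbb P\left(\mathrm{Luce}\big(f(U^1),\dots,f(U^k)\big)=\pi\;\Big|\;U^1,\dots,U^k\right)\Big],$$ where $(U^1,\dots,U^k)$, $U^1<\dots<U^k$, are the order statistics of $k$ i.i.d. uniform random variables on $[0,1]$. (2) The permuton $\mu$ is absolutely continuous with respect to Lebesgue measure on $[0,1]^2$, with density $$\rho(x,y)=\frac{f(x)e^{-f(x)F^{-1}(y)}}{\int_0^1 f(t)e^{-f(t)F^{-1}(y)}\,dt},\qquad (x,y)\in(0,1)^2.$$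
   Context: A permuton is a Borel probability measure on $[0,1]^2$ with both marginals uniform on $[0,1]$. $\mathcal S_k$ is the set of permutations of $[k]=\{1,\dots,k\}$. For a permuton $\mu$, $\mathrm{Perm}(\mu,k)$ is the random permutation $\sigma\in\mathcal S_k$ obtained by sampling $k$ independent points in $[0,1]^2$ with law $\mu$ and setting $\sigma(i)=j$ if the point with $i$-th lowest $x$-coordinate has $j$-th lowest $y$-coordinate (almost surely well defined). Luce distribution: for positive reals $x_1,\dots,x_k$ with $w=x_1+\dots+x_k$ let $$p(x_1,\dots,x_k):=\frac{x_1}{w}\cdot\frac{x_2}{w-x_1}\cdot\frac{x_3}{w-x_1-x_2}\cdots\frac{x_k}{x_k}.$$ $\mathrm{Luce}(\theta_1,\dots,\theta_k)$ denotes a random permutation (or its law) of $[k]$ taking the value $\pi\in\mathcal S_k$ with probability $p(\theta_{\pi^{-1}(1)},\dots,\theta_{\pi^{-1}(k)})$; with random weights this is understood conditionally on the weights. "Uniquely determined by its pattern densities" means that any permuton with the same pattern densities for all $k\ge1$ and $\pi\in\mathcal S_k$ equals $\mu$. *)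

theory Defs
  imports "HOL-Probability.Probability" "HOL-Combinatorics.Permutations"
begin

section \<open>Permutons and their pattern densities\<close>

text \<open>The uniform law on \<open>[0,1]\<close>. Its space is \<open>{0..1}\<close>, not \<open>UNIV\<close>, so that functions need
  only be measurable on the unit interval.\<close>

definition unif01 :: "real measure" where
  "unif01 = restrict_space lborel {0..1}"

definition permuton :: "(real \<times> real) measure \<Rightarrow> bool" where
  "permuton \<mu> \<longleftrightarrow>
     prob_space \<mu> \<and>
     sets \<mu> = sets (restrict_space borel ({0..1} \<times> {0..1})) \<and>
     distr \<mu> unif01 fst = unif01 \<and>
     distr \<mu> unif01 snd = unif01"

definition perms :: "nat \<Rightarrow> (nat \<Rightarrow> nat) set" where
  "perms k = {\<pi>. \<pi> permutes {1..k}}"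

text \<open>If \<open>a 1, \<dots>, a k\<close> are distinct, then \<open>a m\<close> is the \<open>rank k a m\<close>-th lowest among them.\<close>

definition rank :: "nat \<Rightarrow> (nat \<Rightarrow> real) \<Rightarrow> nat \<Rightarrow> nat" where
  "rank k a m = card {j \<in> {1..k}. a j \<le> a m}"

text \<open>The permutation induced by the points \<open>z 1, \<dots>, z k\<close>. The value \<open>id\<close> in the presence of ties
  is a dummy: for independent samples from a permuton ties have probability zero.\<close>

definition perm_of_points :: "nat \<Rightarrow> (nat \<Rightarrow> real \<times> real) \<Rightarrow> nat \<Rightarrow> nat" where
  "perm_of_points k z =
     (if inj_on (\<lambda>m. fst (z m)) {1..k} \<and> inj_on (\<lambda>m. snd (z m)) {1..k}
      then (\<lambda>i. if i \<in> {1..k}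
                then rank k (\<lambda>m. snd (z m)) (the_inv_into {1..k} (rank k (\<lambda>m. fst (z m))) i)
                else i)
      else id)"

text \<open>The law of the random permutation \<open>Perm(\<mu>, k)\<close>.\<close>

definition Perm :: "(real \<times> real) measure \<Rightarrow> nat \<Rightarrow> (nat \<Rightarrow> nat) measure" where
  "Perm \<mu> k = distr (Pi\<^sub>M {1..k} (\<lambda>_. \<mu>)) (count_space (perms k)) (perm_of_points k)"

definition occ :: "nat \<Rightarrow> (nat \<Rightarrow> nat) \<Rightarrow> (real \<times> real) measure \<Rightarrow> real" where
  "occ k \<pi> \<mu> = measure (Perm \<mu> k) {\<pi>}"


section \<open>The Luce distribution\<close>

definition luce_p :: "nat \<Rightarrow> (nat \<Rightarrow> real) \<Rightarrow> real" where
  "luce_p k x = (\<Prod>i = 1..k. x i / ((\<Sum>j = 1..k. x j) - (\<Sum>j = 1..<i. x j)))"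

definition Luce :: "nat \<Rightarrow> (nat \<Rightarrow> real) \<Rightarrow> (nat \<Rightarrow> nat) measure" where
  "Luce k \<theta> = point_measure (perms k) (\<lambda>\<pi>. ennreal (luce_p k (\<lambda>i. \<theta> (inv \<pi> i))))"

definition order_stat :: "nat \<Rightarrow> (nat \<Rightarrow> real) \<Rightarrow> nat \<Rightarrow> real" where
  "order_stat k u i = sort (map u [1..<Suc k]) ! (i - 1)"


section \<open>The limiting permuton\<close>

definition luce_F :: "(real \<Rightarrow> real) \<Rightarrow> real \<Rightarrow> real" where
  "luce_F f x = 1 - (\<integral>y. exp (- x * f y) \<partial>unif01)"

text \<open>The law of an exponential variable of parameter \<open>1\<close>, as a measure on \<open>[0,\<infinity>)\<close>: only for
  nonnegative arguments is \<open>luce_F f\<close> guaranteed to take values in \<open>[0,1]\<close>.\<close>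

definition expo1 :: "real measure" where
  "expo1 = density (restrict_space lborel {0..}) (\<lambda>x. ennreal (exponential_density 1 x))"

definition luce_permuton :: "(real \<Rightarrow> real) \<Rightarrow> (real \<times> real) measure" where
  "luce_permuton f =
     distr (unif01 \<Otimes>\<^sub>M expo1) (restrict_space borel ({0..1} \<times> {0..1}))
       (\<lambda>(u, e). (u, luce_F f (e / f u)))"

text \<open>Here \<open>luce_F f\<close> is inverted as a map on \<open>[0,\<infinity>)\<close>, whose image is \<open>[0,1)\<close>.\<close>

definition luce_density :: "(real \<Rightarrow> real) \<Rightarrow> real \<Rightarrow> real \<Rightarrow> real" where
  "luce_density f x y =
     f x * exp (- f x * the_inv_into {0..} (luce_F f) y) /
     (\<integral>t. f t * exp (- f t * the_inv_into {0..} (luce_F f) y) \<partial>unif01)"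

end

theory Submission
  imports Defs
begin

text \<open>Attach to every label \<open>u\<close> in \<open>[0,1]\<close> a clock that rings at time \<open>T = E / f u\<close>, an exponential time of
  rate \<open>f u\<close>. The Luce permuton is the law of \<open>(U, F T)\<close>, and \<open>F\<close> is exactly the distribution function of
  \<open>T\<close> for a uniform label \<open>U\<close>; it is continuous and strictly increasing, so \<open>F T\<close> is uniform and the order
  of the second coordinates is the order in which the clocks ring.

  \<^emph>\<open>Density.\<close> Given the label \<open>u\<close>, the time \<open>T\<close> has density \<open>f u * exp (- f u * t)\<close>, so the joint law of
  \<open>(U, T)\<close> is known (\<open>arrival_density\<close>), and by Tonelli \<open>T\<close> itself has density
  \<open>h t = \<integral>u. f u * exp (- f u * t)\<close> (\<open>time_law_density\<close>). Hence \<open>(U, T)\<close> has density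
  \<open>f u * exp (- f u * t) / h t\<close> relative to the product of its marginals. The map \<open>(u, t) \<mapsto> (u, F t)\<close> is
  injective and sends that product to Lebesgue measure on the square, so the density is carried over
  with \<open>t\<close> replaced by the inverse of \<open>F\<close> at \<open>y\<close>. This argument does not differentiate \<open>F\<close>, which matters
  because \<open>f\<close> need not be integrable and \<open>F\<close> may have an infinite slope at \<open>0\<close>.

  \<^emph>\<open>Pattern densities.\<close> Condition on the labels of the \<open>k\<close> sample points. The sampled permutation equals
  \<open>\<pi>\<close> precisely if the clocks ring in the order prescribed by \<open>\<pi>\<close>
  (\<open>perm_of_points_eq_iff_chain\<close>), and the memoryless property turns the probability of a given ringing
  order into the Luce product (\<open>exponential_race\<close>).

  \<^emph>\<open>Uniqueness.\<close> The marginals of a permuton are uniform, so the moment of order \<open>(a, b)\<close> is the probability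
  that, among \<open>a + b + 1\<close> samples, one distinguished point has its first coordinate above those of \<open>a\<close>
  given points and its second coordinate above those of \<open>b\<close> others. This event is about relative
  orders only; since the samples are exchangeable, its probability is an average over relabellings, and
  thus a linear function of the pattern densities (\<open>moment_eq_pattern_densities\<close>). By the
  Stone-Weierstrass theorem the moments determine the measure.\<close>

section \<open>Uniform coordinates\<close>

lemma space_unif01 [simp]: "space unif01 = {0..1}"
  by (simp add: unif01_def space_restrict_space)

lemma sets_unif01: "sets unif01 = sets (restrict_space borel {0..1})"
  by (simp add: unif01_def sets_restrict_space)

lemma unif01_sets_iff: "A \<in> sets unif01 \<longleftrightarrow> A \<in> sets borel \<and> A \<subseteq> {0..1}"
  by (auto simp: sets_unif01 sets_restrict_space_iff)

lemma measurable_unif01_iff: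
  "g \<in> measurable N unif01 \<longleftrightarrow> g \<in> borel_measurable N \<and> (\<forall>x\<in>space N. g x \<in> {0..1})"
  by (subst measurable_cong_sets[OF refl sets_unif01], subst measurable_restrict_space2_iff) auto

lemma id_measurable_unif01 [measurable]: "(\<lambda>x. x) \<in> borel_measurable unif01"
  by (subst measurable_cong_sets[OF sets_unif01 refl]) (auto intro: measurable_restrict_space1)

lemma emeasure_unif01: "A \<in> sets unif01 \<Longrightarrow> emeasure unif01 A = emeasure lborel A"
  by (auto simp: unif01_def emeasure_restrict_space unif01_sets_iff sets_restrict_space_iff)

lemma prob_space_unif01: "prob_space unif01"
  by standard (auto simp: emeasure_unif01 unif01_sets_iff)

lemma emeasure_unif01_singleton: "emeasure unif01 {x} = 0"
  by (cases "x \<in> {0..1}") (auto simp: emeasure_unif01 unif01_sets_iff intro: emeasure_notin_sets)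

lemma emeasure_unif01_atMost:
  assumes "b \<in> {0..1}" shows "emeasure unif01 {0..b} = ennreal b"
  using assms by (subst emeasure_unif01) (auto simp: unif01_sets_iff)

text \<open>The distribution function characterizes the uniform law. Values below \<open>1\<close> suffice, so the criterion
  can be applied to images under \<open>F\<close>, whose range omits \<open>1\<close>.\<close>

lemma unif01_eqI:
  assumes N: "prob_space N" and sets: "sets N = sets unif01"
    and cdf: "\<And>b. 0 \<le> b \<Longrightarrow> b < 1 \<Longrightarrow> emeasure N {0..b} = ennreal b"
  shows "N = unif01"
proof -
  interpret N: prob_space N by fact
  interpret U: prob_space unif01 by (rule prob_space_unif01)
  have spN: "space N = {0..1}" using sets_eq_imp_space_eq[OF sets] by simp
  have [measurable]: "(\<lambda>x. x) \<in> borel_measurable N"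
    using id_measurable_unif01 measurable_cong_sets[OF sets refl] by blast
  have "distr N borel (\<lambda>x. x) = distr unif01 borel (\<lambda>x. x)"
  proof (rule cdf_unique')
    show "finite_borel_measure (distr N borel (\<lambda>x. x))"
      "finite_borel_measure (distr unif01 borel (\<lambda>x. x))"
      by (auto intro!: real_distribution.finite_borel_measure_M N.real_distribution_distr
          U.real_distribution_distr)
    show "cdf (distr N borel (\<lambda>x. x)) = cdf (distr unif01 borel (\<lambda>x. x))"
    proof
      fix b :: real
      have *: "measure N ({..b} \<inter> {0..1}) = measure unif01 ({..b} \<inter> {0..1})"
      proof -
        consider "b < 0" | "0 \<le> b" "b < 1" | "1 \<le> b" by linarith
        then show ?thesis
        proof cases
          case 1
          then have "{..b} \<inter> {0..1} = {}" by auto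
          then show ?thesis by simp
        next
          case 2
          then have "{..b} \<inter> {0..1} = {0..b}" by auto
          with cdf[OF 2] emeasure_unif01_atMost[of b] 2 show ?thesis by (simp add: measure_def)
        next
          case 3
          then have "{..b} \<inter> {0..1} = {0..1}" by auto
          with N.prob_space U.prob_space spN show ?thesis by simp
        qed
      qed
      then show "cdf (distr N borel (\<lambda>x. x)) b = cdf (distr unif01 borel (\<lambda>x. x)) b"
        by (simp add: cdf_def measure_distr spN)
    qed
  qed
  then have *: "emeasure (distr N borel (\<lambda>x. x)) A = emeasure (distr unif01 borel (\<lambda>x. x)) A" for A
    by simp
  show ?thesis
  proof (rule measure_eqI[OF sets])
    fix A assume "A \<in> sets N"
    then have "A \<in> sets borel" "A \<inter> {0..1} = A" by (auto simp: sets unif01_sets_iff)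
    with *[of A] show "emeasure N A = emeasure unif01 A"
      by (simp add: emeasure_distr spN)
  qed
qed

text \<open>Two independent variables, one of which is atomless, almost surely differ: integrate over one of
  them with the other one fixed. The functions \<open>g i\<close> may depend on the index, as is needed for clocks of
  different rates.\<close>

lemma AE_PiM_inj_on:
  fixes M :: "'i \<Rightarrow> 'a measure" and g :: "'i \<Rightarrow> 'a \<Rightarrow> real"
  assumes fin: "finite I" and M: "\<And>i. i \<in> I \<Longrightarrow> prob_space (M i)"
    and g: "\<And>i. i \<in> I \<Longrightarrow> g i \<in> borel_measurable (M i)"
    and atom: "\<And>i c. i \<in> I \<Longrightarrow> emeasure (M i) {y \<in> space (M i). g i y = c} = 0"
  shows "AE u in PiM I M. inj_on (\<lambda>i. g i (u i)) I"
proof -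
  \<comment> \<open>The product construction wants a probability space at every index; outside \<open>I\<close> any one will do.\<close>
  define M' where "M' i = (if i \<in> I then M i else return (count_space UNIV) undefined)" for i
  interpret product_prob_space M'
    by (intro product_prob_spaceI) (auto simp: M'_def M prob_space_return)
  have eq: "PiM I M = PiM I M'" by (intro PiM_cong) (auto simp: M'_def)
  have "AE u in PiM I M'. g i (u i) \<noteq> g j (u j)" if ij: "i \<in> I" "j \<in> I" "i \<noteq> j" for i j
  proof -
    let ?D = "\<lambda>u. indicator {u \<in> space (PiM I M'). g i (u i) = g j (u j)} u :: ennreal"
    have gm [measurable]: "g l \<in> borel_measurable (M' l)" if "l \<in> I" for l
      using that g by (simp add: M'_def)
    have comp [measurable]: "(\<lambda>u. g l (u l)) \<in> borel_measurable (PiM I M')" if "l \<in> I" for l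
      by (rule measurable_compose[where M = "PiM I M'" and N = "M' l" and f = "\<lambda>u. u l", OF measurable_component_singleton[OF that] gm[OF that]])
    have m: "?D \<in> borel_measurable (PiM I M')"
      using ij by measurable
    have I: "I = insert i (I - {i})" using ij by auto
    have "(\<integral>\<^sup>+u. ?D u \<partial>PiM (insert i (I - {i})) M') =
        (\<integral>\<^sup>+u. (\<integral>\<^sup>+y. ?D (u(i := y)) \<partial>M' i) \<partial>PiM (I - {i}) M')"
      using fin m I by (intro product_nn_integral_insert) auto
    also have "\<dots> = (\<integral>\<^sup>+u. 0 \<partial>PiM (I - {i}) M')"
    proof (rule nn_integral_cong)
      fix u assume u: "u \<in> space (PiM (I - {i}) M')"
      have "(\<integral>\<^sup>+y. ?D (u(i := y)) \<partial>M' i) = (\<integral>\<^sup>+y. indicator {y \<in> space (M' i). g i y = g j (u j)} y \<partial>M' i)"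
        using ij u by (intro nn_integral_cong)
          (auto simp: indicator_def space_PiM PiE_iff extensional_def)
      also have "\<dots> = emeasure (M' i) {y \<in> space (M' i). g i y = g j (u j)}"
        using ij by (intro nn_integral_indicator) measurable
      also have "\<dots> = 0"
        using atom ij by (simp add: M'_def)
      finally show "(\<integral>\<^sup>+y. ?D (u(i := y)) \<partial>M' i) = 0" .
    qed
    finally have "(\<integral>\<^sup>+u. ?D u \<partial>PiM I M') = 0" using I by simp
    then have "AE u in PiM I M'. ?D u = 0"
      using m by (subst (asm) nn_integral_0_iff_AE) auto
    then show ?thesis
      using AE_space by eventually_elim (auto simp: indicator_def split: if_splits)
  qed
  then have "AE u in PiM I M'. \<forall>i\<in>I. \<forall>j\<in>I. i \<noteq> j \<longrightarrow> g i (u i) \<noteq> g j (u j)"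
    using fin by (intro AE_finite_allI) auto
  then show ?thesis unfolding eq by eventually_elim (auto simp: inj_on_def)
qed

section \<open>Exponential clocks and the transform \<open>F\<close>\<close>

lemma space_expo1 [simp]: "space expo1 = {0..}"
  by (simp add: expo1_def space_restrict_space)

lemma sets_expo1: "sets expo1 = sets (restrict_space borel {0..})"
  by (simp add: expo1_def sets_restrict_space)

lemma id_measurable_expo1 [measurable]: "(\<lambda>x. x) \<in> borel_measurable expo1"
  by (subst measurable_cong_sets[OF sets_expo1 refl]) (auto intro: measurable_restrict_space1)

lemma nn_integral_expo1:
  assumes g: "g \<in> borel_measurable expo1"
  shows "(\<integral>\<^sup>+e. g e \<partial>expo1) = (\<integral>\<^sup>+e. g e * ennreal (exp (- e)) * indicator {0..} e \<partial>lborel)"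
proof -
  have g': "g \<in> borel_measurable (restrict_space lborel {0..})"
    using g by (simp add: expo1_def)
  show ?thesis
    unfolding expo1_def
    by (subst nn_integral_density[OF measurable_restrict_space1])
       (auto intro!: nn_integral_cong simp: nn_integral_restrict_space exponential_density_def
         erlang_density_def indicator_def g' mult.commute)
qed

lemma expo1_tail:
  assumes "0 \<le> c" shows "(\<integral>\<^sup>+e. indicator {c<..} e \<partial>expo1) = ennreal (exp (- c))"
proof -
  have [measurable]: "(indicator {c<..} :: real \<Rightarrow> ennreal) \<in> borel_measurable expo1"
    by (rule measurable_compose[OF id_measurable_expo1]) simp
  have "(\<integral>\<^sup>+e. indicator {c<..} e \<partial>expo1) = (\<integral>\<^sup>+e. ennreal (exp (- e)) * indicator {c..} e \<partial>lborel)"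
    using assms AE_lborel_singleton[of c]
    by (subst nn_integral_expo1) (auto intro!: nn_integral_cong_AE simp: indicator_def)
  also have "\<dots> = ennreal (0 - (- exp (- c)))"
  proof (rule nn_integral_FTC_atLeast)
    show "((\<lambda>x::real. - exp (- x)) \<longlongrightarrow> 0) at_top"
      using tendsto_minus[OF filterlim_compose[OF exp_at_bot filterlim_uminus_at_bot_at_top]] by simp
  qed (auto intro!: derivative_eq_intros)
  finally show ?thesis by simp
qed

lemma prob_space_expo1: "prob_space expo1"
proof
  have "emeasure expo1 (space expo1) = (\<integral>\<^sup>+e. indicator {0..} e \<partial>expo1)"
    using nn_integral_indicator[OF sets.top[of expo1]] by simp
  also have "\<dots> = (\<integral>\<^sup>+e. ennreal (exp (- e)) * indicator {0..} e \<partial>lborel)"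
  proof -
    have "(indicator {0..} :: real \<Rightarrow> ennreal) \<in> borel_measurable expo1"
      by (rule measurable_compose[OF id_measurable_expo1]) simp
    then show ?thesis
      by (subst nn_integral_expo1) (auto intro!: nn_integral_cong simp: indicator_def)
  qed
  also have "\<dots> = ennreal (0 - (- exp (- 0)))"
  proof (rule nn_integral_FTC_atLeast)
    show "((\<lambda>x::real. - exp (- x)) \<longlongrightarrow> 0) at_top"
      using tendsto_minus[OF filterlim_compose[OF exp_at_bot filterlim_uminus_at_bot_at_top]] by simp
  qed (auto intro!: derivative_eq_intros)
  finally show "emeasure expo1 (space expo1) = 1" by simp
qed

text \<open>The weight function of the theorem, with the distribution function \<open>F\<close> of the ringing time of a
  uniformly chosen label.\<close>

locale luce_weight =
  fixes f :: "real \<Rightarrow> real"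
  assumes meas: "f \<in> borel_measurable (restrict_space borel {0..1})"
    and pos: "\<And>x. x \<in> {0..1} \<Longrightarrow> f x > 0"
begin

lemma f_measurable [measurable]: "f \<in> borel_measurable unif01"
  using meas measurable_cong_sets[OF sets_unif01 refl] by blast

lemma f_pos: "u \<in> space unif01 \<Longrightarrow> f u > 0"
  using pos by simp

sublocale U: prob_space unif01 by (rule prob_space_unif01)
sublocale E: prob_space expo1 by (rule prob_space_expo1)
sublocale UE: pair_prob_space unif01 expo1 ..

abbreviation "F \<equiv> luce_F f"

lemma integrable_exp: "0 \<le> t \<Longrightarrow> integrable unif01 (\<lambda>u. exp (- t * f u))"
  by (rule U.integrable_const_bound[where B = 1])
     (auto intro!: AE_I2 simp: less_imp_le[OF f_pos])

lemma F_strict_mono: "0 \<le> s \<Longrightarrow> s < t \<Longrightarrow> F s < F t"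
proof -
  assume st: "0 \<le> s" "s < t"
  have "(\<integral>u. exp (- t * f u) \<partial>unif01) < (\<integral>u. exp (- s * f u) \<partial>unif01)"
  proof (rule U.integral_less_AE_space)
    show "AE u in unif01. exp (- t * f u) < exp (- s * f u)"
      using st f_pos by (intro AE_I2) auto
  qed (use st in \<open>auto simp: integrable_exp[simplified] U.emeasure_space_1 simp del: space_unif01\<close>)
  then show ?thesis by (simp add: luce_F_def)
qed

lemma F_0: "F 0 = 0"
  using U.prob_space by (simp add: luce_F_def)

lemma F_less_1: "0 \<le> t \<Longrightarrow> F t < 1"
proof -
  assume t: "0 \<le> t"
  have "(\<integral>u. 0 \<partial>unif01) < (\<integral>u. exp (- t * f u) \<partial>unif01)"
    by (rule U.integral_less_AE_space)
       (use t in \<open>auto simp: integrable_exp[simplified] U.emeasure_space_1 simp del: space_unif01\<close>)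
  then show ?thesis by (simp add: luce_F_def)
qed

lemma F_nonneg: "0 \<le> t \<Longrightarrow> 0 \<le> F t"
  using F_strict_mono[of 0 t] F_0 by (cases "t = 0") auto

lemma F_inj_on: "inj_on F {0..}"
  by (intro linorder_inj_onI) (auto dest: F_strict_mono)

lemma F_less_iff: "0 \<le> s \<Longrightarrow> 0 \<le> t \<Longrightarrow> F s < F t \<longleftrightarrow> s < t"
  by (metis F_strict_mono linorder_less_linear not_less_iff_gr_or_eq)

lemma F_le_iff: "0 \<le> s \<Longrightarrow> 0 \<le> t \<Longrightarrow> F s \<le> F t \<longleftrightarrow> s \<le> t"
  using F_less_iff[of t s] by (simp add: not_less[symmetric])

lemma F_continuous: "continuous_on {0..} F"
  unfolding luce_F_def
proof (intro continuous_intros)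
  show "continuous_on {0..} (\<lambda>t. \<integral>u. exp (- t * f u) \<partial>unif01)"
    unfolding continuous_on_sequentially
  proof (intro allI ballI impI, elim conjE)
    fix X :: "nat \<Rightarrow> real" and t :: real
    assume X: "\<forall>n. X n \<in> {0..}" "X \<longlonglongrightarrow> t"
    have "(\<lambda>n. \<integral>u. exp (- X n * f u) \<partial>unif01) \<longlonglongrightarrow> (\<integral>u. exp (- t * f u) \<partial>unif01)"
      by (rule integral_dominated_convergence[where w = "\<lambda>_. 1"])
         (use X in \<open>auto intro!: AE_I2 tendsto_intros simp: less_imp_le[OF f_pos]\<close>)
    then show "((\<lambda>t. \<integral>u. exp (- t * f u) \<partial>unif01) \<circ> X) \<longlonglongrightarrow> (\<integral>u. exp (- t * f u) \<partial>unif01)"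
      by (simp add: o_def)
  qed
qed

lemma F_tendsto_1: "(F \<longlongrightarrow> 1) at_top"
proof -
  have "((\<lambda>t. \<integral>u. exp (- t * f u) \<partial>unif01) \<longlongrightarrow> (\<integral>u. 0 \<partial>unif01)) at_top"
  proof (rule integral_dominated_convergence_at_top)
    show "AE u in unif01. ((\<lambda>t. exp (- t * f u)) \<longlongrightarrow> 0) at_top"
    proof (rule AE_I2)
      fix u assume "u \<in> space unif01"
      with f_pos have "f u > 0" by blast
      then have "LIM t at_top. - t * f u :> at_bot"
        by (subst mult.commute, intro filterlim_tendsto_pos_mult_at_bot[OF tendsto_const])
           (auto simp: filterlim_uminus_at_bot_at_top)
      then show "((\<lambda>t. exp (- t * f u)) \<longlongrightarrow> 0) at_top"
        by (rule filterlim_compose[OF exp_at_bot])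
    qed
    show "\<forall>\<^sub>F t in at_top. AE u in unif01. norm (exp (- t * f u)) \<le> 1"
      using eventually_ge_at_top[of 0]
      by eventually_elim (auto intro!: AE_I2 simp: less_imp_le[OF f_pos])
  qed auto
  then show ?thesis
    unfolding luce_F_def by (auto intro!: tendsto_eq_intros)
qed

text \<open>The inverse of \<open>F\<close> on \<open>[0,1)\<close> that enters the density.\<close>

definition "G = the_inv_into {0..} F"

text \<open>By dominated convergence \<open>F\<close> is continuous and tends to \<open>1\<close>, so the intermediate value theorem applies.\<close>

lemma F_surj: 
  assumes "0 \<le> y" "y < 1" shows "\<exists>t\<ge>0. F t = y"
proof -
  have "\<forall>\<^sub>F t in at_top. F t > y"
    using F_tendsto_1 assms by (auto simp: order_tendsto_iff)
  then obtain T where T: "T \<ge> 0" "F T > y"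
    using eventually_happens'[OF _ eventually_conj[OF _ eventually_ge_at_top[of 0]]]
    by (metis trivial_limit_at_top_linorder)
  have "\<exists>t\<ge>0. t \<le> T \<and> F t = y"
    using T assms F_0 F_continuous
    by (intro IVT') (auto intro: continuous_on_subset)
  then show ?thesis by blast
qed

lemma G_F: "0 \<le> t \<Longrightarrow> G (F t) = t"
  by (simp add: G_def the_inv_into_f_f[OF F_inj_on])

lemma F_G: "0 \<le> y \<Longrightarrow> y < 1 \<Longrightarrow> F (G y) = y"
  using F_surj G_F by metis

lemma G_nonneg: "0 \<le> y \<Longrightarrow> y < 1 \<Longrightarrow> 0 \<le> G y"
  using F_surj G_F by metis

lemma G_measurable: "G \<in> borel_measurable (restrict_space borel {0..<1})"
proof (rule borel_measurable_mono_on_fnc)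
  show "mono_on {0..<1} G"
  proof (intro mono_onI)
    fix r s :: real assume "r \<in> {0..<1}" "s \<in> {0..<1}" "r \<le> s"
    then show "G r \<le> G s"
      using F_le_iff[of "G r" "G s"] by (simp add: G_nonneg F_G)
  qed
qed

lemma F_measurable: "F \<in> borel_measurable (restrict_space borel {0..})"
  using F_continuous by (rule borel_measurable_continuous_on_restrict)

end

section \<open>The density of the Luce permuton\<close>

definition half_line :: "real measure" where
  "half_line = restrict_space lborel {0..}"

lemma space_half_line [simp]: "space half_line = {0..}"
  by (simp add: half_line_def space_restrict_space)

lemma sets_half_line: "sets half_line = sets (restrict_space borel {0..})"
  by (simp add: half_line_def sets_restrict_space)

lemma id_measurable_half_line [measurable]: "(\<lambda>x. x) \<in> borel_measurable half_line"
  by (subst measurable_cong_sets[OF sets_half_line refl]) (auto intro: measurable_restrict_space1)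

lemma measurable_half_line_iff:
  "g \<in> measurable N half_line \<longleftrightarrow> g \<in> borel_measurable N \<and> (\<forall>x\<in>space N. g x \<in> {0..})"
  by (subst measurable_cong_sets[OF refl sets_half_line], subst measurable_restrict_space2_iff) auto

lemma sigma_finite_half_line: "sigma_finite_measure half_line"
  unfolding half_line_def
  by (rule sigma_finite_measure_restrict_space) (auto simp: lborel.sigma_finite_measure_axioms)

text \<open>A unit exponential time divided by \<open>c\<close> is an exponential time of rate \<open>c\<close>, by a linear substitution.\<close>

lemma nn_integral_expo1_rate:
  assumes c: "0 < c" and g [measurable]: "g \<in> borel_measurable half_line"
  shows "(\<integral>\<^sup>+e. g (e / c) \<partial>expo1) = (\<integral>\<^sup>+t. ennreal (c * exp (- c * t)) * g t \<partial>half_line)"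
proof -
  define g' where "g' t = g t * indicator {0..} t" for t
  have g' [measurable]: "g' \<in> borel_measurable borel"
    using g unfolding g'_def half_line_def
    by (subst (asm) borel_measurable_restrict_space_iff_ennreal) auto
  have m: "(\<lambda>t. g' t * ennreal (exp (- (c * t)))) \<in> borel_measurable borel"
    by measurable
  have gm: "(\<lambda>e. g (e / c)) \<in> borel_measurable expo1"
  proof (rule measurable_compose[OF _ g])
    show "(\<lambda>e. e / c) \<in> expo1 \<rightarrow>\<^sub>M half_line"
      using c by (auto simp: measurable_half_line_iff)
  qed
  have "(\<integral>\<^sup>+e. g (e / c) \<partial>expo1) = (\<integral>\<^sup>+e. g' (e / c) * ennreal (exp (- e)) \<partial>lborel)"
    using c by (subst nn_integral_expo1[OF gm])
      (auto intro!: nn_integral_cong simp: g'_def indicator_def zero_le_divide_iff)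
  also have "(\<integral>\<^sup>+e. g' (e / c) * ennreal (exp (- e)) \<partial>lborel) = ennreal c * (\<integral>\<^sup>+t. g' t * ennreal (exp (- (c * t))) \<partial>lborel)"
    using c by (subst nn_integral_real_affine[where c = c and t = 0]) auto
  also have "\<dots> = (\<integral>\<^sup>+t. ennreal (c * exp (- c * t)) * g t * indicator {0..} t \<partial>lborel)"
    using c m by (subst nn_integral_cmult[symmetric])
      (auto intro!: nn_integral_cong simp: g'_def indicator_def ennreal_mult mult_ac)
  also have "\<dots> = (\<integral>\<^sup>+t. ennreal (c * exp (- c * t)) * g t \<partial>half_line)"
    by (simp add: half_line_def nn_integral_restrict_space)
  finally show ?thesis .
qed

abbreviation "square \<equiv> {0..1::real} \<times> {0..1::real}"

lemma square_borel [measurable]: "square \<in> sets borel"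
  by (intro borel_Times) auto

text \<open>Permutons carry the trace of the Borel sets of the plane, whereas independent uniform variables give a
  product of traces. The two \<open>\<sigma>\<close>-algebras agree, because the Borel sets of the plane are generated by
  rectangles.\<close>

lemma sets_unif01_pair: "sets (unif01 \<Otimes>\<^sub>M unif01) = sets (restrict_space borel square)"
proof (rule antisym)
  show "sets (unif01 \<Otimes>\<^sub>M unif01) \<subseteq> sets (restrict_space borel square)"
    by (rule sets_pair_in_sets) (auto simp: unif01_sets_iff sets_restrict_space_iff square_borel intro!: borel_Times)
  have id: "(\<lambda>z. (fst z, snd z)) \<in> unif01 \<Otimes>\<^sub>M unif01 \<rightarrow>\<^sub>M borel \<Otimes>\<^sub>M borel"
    by measurable
  show "sets (restrict_space borel square) \<subseteq> sets (unif01 \<Otimes>\<^sub>M unif01)"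
  proof
    fix A assume "A \<in> sets (restrict_space borel square)"
    then have A: "A \<in> sets (borel \<Otimes>\<^sub>M borel)" "A \<subseteq> square"
      unfolding borel_prod by (auto simp: sets_restrict_space_iff square_borel)
    from measurable_sets[OF id A(1)] A(2) show "A \<in> sets (unif01 \<Otimes>\<^sub>M unif01)"
      by (simp add: space_pair_measure vimage_def Int_absorb2)
  qed
qed

lemma unif01_pair: "unif01 \<Otimes>\<^sub>M unif01 = restrict_space lborel square"
proof (rule pair_measure_eqI)
  show "sigma_finite_measure unif01" "sigma_finite_measure unif01"
    using prob_space_unif01 by (auto simp: prob_space_imp_sigma_finite)
  show "sets (unif01 \<Otimes>\<^sub>M unif01) = sets (restrict_space lborel square)"
    by (simp add: sets_unif01_pair sets_restrict_space)
  fix A B assume AB: "A \<in> sets unif01" "B \<in> sets unif01"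
  then have "A \<times> B \<in> sets borel" "A \<times> B \<subseteq> square"
    by (auto simp: unif01_sets_iff intro!: borel_Times)
  then have "emeasure (restrict_space lborel square) (A \<times> B) = emeasure (lborel \<Otimes>\<^sub>M lborel) (A \<times> B)"
    by (subst emeasure_restrict_space) (auto simp: lborel_prod intro!: borel_Times)
  also have "\<dots> = emeasure unif01 A * emeasure unif01 B"
    using AB by (subst lborel.emeasure_pair_measure_Times) (auto simp: unif01_sets_iff emeasure_unif01)
  finally show "emeasure unif01 A * emeasure unif01 B = emeasure (restrict_space lborel square) (A \<times> B)"
    by simp
qed

context luce_weight
begin

sublocale H: sigma_finite_measure half_line by (rule sigma_finite_half_line)
sublocale UH: pair_sigma_finite unif01 half_line ..

lemma F_measurable_half_line: "F \<in> half_line \<rightarrow>\<^sub>M unif01"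
  using F_measurable F_nonneg F_less_1 measurable_cong_sets[OF sets_half_line refl, of borel]
  by (auto simp: measurable_unif01_iff less_imp_le)

lemma time_measurable: "(\<lambda>z. snd z / f (fst z)) \<in> unif01 \<Otimes>\<^sub>M expo1 \<rightarrow>\<^sub>M half_line"
proof -
  have "(\<lambda>z. snd z / f (fst z)) \<in> borel_measurable (unif01 \<Otimes>\<^sub>M expo1)"
    by measurable
  then show ?thesis
    by (auto simp: measurable_half_line_iff space_pair_measure intro!: divide_nonneg_nonneg less_imp_le[OF pos])
qed

text \<open>The joint law of a uniform label and the time at which its clock rings.\<close>

definition arrival :: "(real \<times> real) measure" where
  "arrival = distr (unif01 \<Otimes>\<^sub>M expo1) (unif01 \<Otimes>\<^sub>M half_line) (\<lambda>z. (fst z, snd z / f (fst z)))"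

lemma arrival_measurable:
  "(\<lambda>z. (fst z, snd z / f (fst z))) \<in> unif01 \<Otimes>\<^sub>M expo1 \<rightarrow>\<^sub>M unif01 \<Otimes>\<^sub>M half_line"
  using time_measurable by measurable

lemma prob_space_arrival: "prob_space arrival"
  unfolding arrival_def by (rule UE.prob_space_distr[OF arrival_measurable])

lemma arrival_density:
  "arrival = density (unif01 \<Otimes>\<^sub>M half_line) (\<lambda>z. ennreal (f (fst z) * exp (- f (fst z) * snd z)))"
proof (rule measure_eqI)
  fix A assume "A \<in> sets arrival"
  then have A [measurable]: "A \<in> sets (unif01 \<Otimes>\<^sub>M half_line)" by (simp add: arrival_def)
  have "emeasure arrival A = (\<integral>\<^sup>+z. indicator A z \<partial>arrival)"
    using A by (subst nn_integral_indicator) (auto simp: arrival_def)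
  also have "\<dots> = (\<integral>\<^sup>+z. indicator A (fst z, snd z / f (fst z)) \<partial>(unif01 \<Otimes>\<^sub>M expo1))"
    unfolding arrival_def by (subst nn_integral_distr[OF arrival_measurable]) auto
  also have "\<dots> = (\<integral>\<^sup>+u. (\<integral>\<^sup>+e. indicator A (u, e / f u) \<partial>expo1) \<partial>unif01)"
    by (subst E.nn_integral_fst[symmetric]) (auto intro!: measurable_compose[OF arrival_measurable])
  also have "\<dots> = (\<integral>\<^sup>+u. (\<integral>\<^sup>+t. ennreal (f u * exp (- f u * t)) * indicator A (u, t) \<partial>half_line) \<partial>unif01)"
  proof (rule nn_integral_cong)
    fix u assume u: "u \<in> space unif01"
    then have "(\<lambda>t. indicator A (u, t) :: ennreal) \<in> borel_measurable half_line"
      by measurable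
    then show "(\<integral>\<^sup>+e. indicator A (u, e / f u) \<partial>expo1) =
        (\<integral>\<^sup>+t. ennreal (f u * exp (- f u * t)) * indicator A (u, t) \<partial>half_line)"
      by (rule nn_integral_expo1_rate[OF f_pos[OF u]])
  qed
  also have "\<dots> = (\<integral>\<^sup>+z. ennreal (f (fst z) * exp (- f (fst z) * snd z)) * indicator A z \<partial>(unif01 \<Otimes>\<^sub>M half_line))"
    by (subst H.nn_integral_fst[symmetric]) auto
  also have "\<dots> = emeasure (density (unif01 \<Otimes>\<^sub>M half_line) (\<lambda>z. ennreal (f (fst z) * exp (- f (fst z) * snd z)))) A"
    by (subst emeasure_density) auto
  finally show "emeasure arrival A = \<dots>" .
qed (simp add: arrival_def)

text \<open>The density of the ringing time of a uniformly chosen label; it is the derivative of \<open>F\<close> on the open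
  half-line. At time \<open>0\<close> the integral is that of \<open>f\<close>, which may diverge and then takes the default value \<open>0\<close>.\<close>

definition time_density :: "real \<Rightarrow> real" where
  "time_density t = (\<integral>u. f u * exp (- f u * t) \<partial>unif01)"

lemma time_density_measurable [measurable]: "time_density \<in> borel_measurable borel"
  unfolding time_density_def by measurable

text \<open>Although \<open>f\<close> may be unbounded, \<open>s * exp (- s * t)\<close> is at most \<open>1 / t\<close> for every \<open>s\<close>.\<close>

lemma time_density_integrable:
  assumes t: "0 < t" shows "integrable unif01 (\<lambda>u. f u * exp (- f u * t))"
proof (rule U.integrable_const_bound)
  show "AE u in unif01. norm (f u * exp (- f u * t)) \<le> 1 / t"
  proof (rule AE_I2)
    fix u assume u: "u \<in> space unif01"
    have "f u * t \<le> exp (f u * t)"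
      using exp_ge_add_one_self[of "f u * t"] by linarith
    then show "norm (f u * exp (- f u * t)) \<le> 1 / t"
      using t f_pos[OF u] by (simp add: exp_minus field_simps)
  qed
qed measurable

lemma time_density_pos:
  assumes t: "0 < t" shows "0 < time_density t"
proof -
  have "(\<integral>u. 0 \<partial>unif01) < (\<integral>u. f u * exp (- f u * t) \<partial>unif01)"
    by (rule U.integral_less_AE_space)
       (use f_pos in \<open>auto simp: time_density_integrable[OF t, simplified] U.emeasure_space_1 simp del: space_unif01\<close>)
  then show ?thesis by (simp add: time_density_def)
qed

definition time_law :: "real measure" where
  "time_law = distr arrival half_line snd"

lemma AE_half_line_pos: "AE t in half_line. 0 < t"
  using AE_lborel_singleton[of 0] unfolding half_line_def
  by (subst AE_restrict_space_iff) (auto elim!: eventually_mono)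

lemma time_law_density: "time_law = density half_line (\<lambda>t. ennreal (time_density t))"
proof (rule measure_eqI)
  fix A assume "A \<in> sets time_law"
  then have A [measurable]: "A \<in> sets half_line" by (simp add: time_law_def)
  have "emeasure time_law A = (\<integral>\<^sup>+t. indicator A t \<partial>time_law)"
    using A by (subst nn_integral_indicator) (auto simp: time_law_def)
  also have "\<dots> = (\<integral>\<^sup>+z. indicator A (snd z) \<partial>arrival)"
    unfolding time_law_def by (subst nn_integral_distr) (auto simp: arrival_def)
  also have "\<dots> = (\<integral>\<^sup>+z. ennreal (f (fst z) * exp (- f (fst z) * snd z)) * indicator A (snd z) \<partial>(unif01 \<Otimes>\<^sub>M half_line))"
    unfolding arrival_density by (subst nn_integral_density) auto
  also have "\<dots> = (\<integral>\<^sup>+t. (\<integral>\<^sup>+u. ennreal (f u * exp (- f u * t)) * indicator A t \<partial>unif01) \<partial>half_line)"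
    by (subst UH.nn_integral_snd[symmetric]) auto
  also have "\<dots> = (\<integral>\<^sup>+t. ennreal (time_density t) * indicator A t \<partial>half_line)"
  proof (rule nn_integral_cong_AE)
    show "AE t in half_line. (\<integral>\<^sup>+u. ennreal (f u * exp (- f u * t)) * indicator A t \<partial>unif01) =
        ennreal (time_density t) * indicator A t"
      using AE_half_line_pos
    proof eventually_elim
      case (elim t)
      have "(\<integral>\<^sup>+u. ennreal (f u * exp (- f u * t)) * indicator A t \<partial>unif01) =
          (\<integral>\<^sup>+u. ennreal (f u * exp (- f u * t)) \<partial>unif01) * indicator A t"
        by (rule nn_integral_multc) measurable
      also have "(\<integral>\<^sup>+u. ennreal (f u * exp (- f u * t)) \<partial>unif01) = ennreal (time_density t)"
        unfolding time_density_def
        by (rule nn_integral_eq_integral[OF time_density_integrable[OF elim]])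
           (auto intro!: AE_I2 simp: less_imp_le[OF f_pos])
      finally show ?case .
    qed
  qed
  also have "\<dots> = emeasure (density half_line (\<lambda>t. ennreal (time_density t))) A"
    by (subst emeasure_density) auto
  finally show "emeasure time_law A = \<dots>" .
qed (simp add: time_law_def)

lemma sets_time_law: "sets time_law = sets half_line"
  by (simp add: time_law_def)

lemma prob_space_time_law: "prob_space time_law"
  unfolding time_law_def
  by (rule prob_space.prob_space_distr[OF prob_space_arrival]) (auto simp: arrival_def)

lemma emeasure_time_law:
  assumes c: "0 \<le> c" shows "emeasure time_law {0..c} = ennreal (F c)"
proof -
  have [measurable]: "{0..c} \<in> sets half_line"
    by (auto simp: sets_half_line sets_restrict_space_iff)
  have [measurable]: "(indicator {a<..} :: real \<Rightarrow> ennreal) \<in> borel_measurable expo1" for a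
    by (rule measurable_compose[OF id_measurable_expo1]) simp
  have 1: "snd \<in> arrival \<rightarrow>\<^sub>M half_line" by (auto simp: arrival_def)
  have "emeasure time_law {0..c} = (\<integral>\<^sup>+t. indicator {0..c} t \<partial>time_law)"
    by (subst nn_integral_indicator) (auto simp: sets_time_law)
  also have "\<dots> = (\<integral>\<^sup>+z. indicator {0..c} (snd z) \<partial>arrival)"
    unfolding time_law_def by (subst nn_integral_distr[OF 1]) auto
  also have "\<dots> = (\<integral>\<^sup>+z. indicator {0..c} (snd z / f (fst z)) \<partial>(unif01 \<Otimes>\<^sub>M expo1))"
    unfolding arrival_def by (subst nn_integral_distr[OF arrival_measurable]) auto
  also have "\<dots> = (\<integral>\<^sup>+u. (\<integral>\<^sup>+e. indicator {0..c} (e / f u) \<partial>expo1) \<partial>unif01)"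
    by (subst E.nn_integral_fst[symmetric]) (auto intro!: measurable_compose[OF time_measurable])
  also have "\<dots> = (\<integral>\<^sup>+u. ennreal (1 - exp (- c * f u)) \<partial>unif01)"
  proof (rule nn_integral_cong)
    fix u assume u: "u \<in> space unif01"
    have "(\<integral>\<^sup>+e. indicator {0..c} (e / f u) \<partial>expo1) = (\<integral>\<^sup>+e. 1 - indicator {c * f u<..} e \<partial>expo1)"
      using f_pos[OF u] by (intro nn_integral_cong) (auto simp: indicator_def field_simps)
    also have "\<dots> = (\<integral>\<^sup>+e. 1 \<partial>expo1) - (\<integral>\<^sup>+e. indicator {c * f u<..} e \<partial>expo1)"
      using expo1_tail[of "c * f u"] c f_pos[OF u]
      by (intro nn_integral_diff) (auto simp: indicator_def)
    also have "\<dots> = ennreal (1 - exp (- c * f u))"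
      using expo1_tail[of "c * f u"] c f_pos[OF u] E.emeasure_space_1
        ennreal_minus[of "exp (- (c * f u))" 1] by simp
    finally show "(\<integral>\<^sup>+e. indicator {0..c} (e / f u) \<partial>expo1) = ennreal (1 - exp (- c * f u))" .
  qed
  also have "\<dots> = ennreal (\<integral>u. 1 - exp (- c * f u) \<partial>unif01)"
    using c by (intro nn_integral_eq_integral Bochner_Integration.integrable_diff integrable_exp)
      (auto intro!: AE_I2 mult_nonneg_nonneg simp: less_imp_le[OF f_pos])
  also have "(\<integral>u. 1 - exp (- c * f u) \<partial>unif01) = F c"
    using c U.prob_space by (subst Bochner_Integration.integral_diff)
      (auto simp: luce_F_def integrable_exp[simplified])
  finally show ?thesis .
qed

text \<open>The probability integral transform: a continuous distribution function maps its own law to the uniform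
  law.\<close>

lemma F_time_law: "distr time_law unif01 F = unif01"
proof (rule unif01_eqI)
  have Fm: "F \<in> time_law \<rightarrow>\<^sub>M unif01"
    using F_measurable_half_line measurable_cong_sets[OF sets_time_law refl] by blast
  then show "prob_space (distr time_law unif01 F)"
    by (rule prob_space.prob_space_distr[OF prob_space_time_law])
  fix b :: real assume b: "0 \<le> b" "b < 1"
  have "F -` {0..b} \<inter> space time_law = {0..G b}"
    using b F_le_iff[of _ "G b"] F_nonneg sets_eq_imp_space_eq[OF sets_time_law]
    by (auto simp: F_G G_nonneg)
  then have "emeasure (distr time_law unif01 F) {0..b} = emeasure time_law {0..G b}"
    using b by (subst emeasure_distr[OF Fm]) (auto simp: unif01_sets_iff)
  also have "\<dots> = ennreal b"
    using b by (simp add: emeasure_time_law G_nonneg F_G)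
  finally show "emeasure (distr time_law unif01 F) {0..b} = ennreal b" .
qed simp

abbreviation "\<rho> \<equiv> (\<lambda>(x, y). if (x, y) \<in> {0<..<1} \<times> {0<..<1} then ennreal (luce_density f x y) else 0)"

lemma luce_density_eq: "luce_density f x y = f x * exp (- f x * G y) / time_density (G y)"
  by (simp add: luce_density_def time_density_def G_def)

lemma luce_density_measurable: "\<rho> \<in> borel_measurable (unif01 \<Otimes>\<^sub>M unif01)"
proof -
  define G' where "G' y = (if y \<in> {0..<1} then G y else 0)" for y
  have "G' \<in> borel_measurable borel"
    unfolding G'_def using G_measurable
    by (subst measurable_restrict_space_iff[symmetric]) auto
  then have [measurable]: "G' \<in> borel_measurable unif01"
    using measurable_compose[OF id_measurable_unif01] by blast
  have "(\<lambda>z. if 0 < fst z \<and> fst z < 1 \<and> 0 < snd z \<and> snd z < 1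
      then ennreal (f (fst z) * exp (- f (fst z) * G' (snd z)) / time_density (G' (snd z))) else 0)
      \<in> borel_measurable (unif01 \<Otimes>\<^sub>M unif01)"
    by measurable
  then show ?thesis
    by (rule measurable_cong[THEN iffD1, rotated]) (auto simp: G'_def luce_density_eq)
qed

text \<open>Relative to the product of the marginals, the joint density gets divided by the density of the time. The
  quotient is expressed through \<open>F t\<close> instead of \<open>t\<close>, which is the form in which it survives the
  passage to the image under \<open>F\<close>.\<close>

lemma arrival_density_product:
  "arrival = density (unif01 \<Otimes>\<^sub>M time_law) (\<lambda>z. \<rho> (fst z, F (snd z)))"
proof -
  have [measurable]: "F \<in> half_line \<rightarrow>\<^sub>M unif01" by (rule F_measurable_half_line)
  have \<rho>F [measurable]: "(\<lambda>z. \<rho> (fst z, F (snd z))) \<in> borel_measurable (unif01 \<Otimes>\<^sub>M half_line)"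
    by (rule measurable_compose[OF _ luce_density_measurable]) measurable
  have "sigma_finite_measure time_law"
    using prob_space_time_law by (rule prob_space_imp_sigma_finite)
  then have "unif01 \<Otimes>\<^sub>M time_law = density (unif01 \<Otimes>\<^sub>M half_line) (\<lambda>z. ennreal (time_density (snd z)))"
    using pair_measure_density[of "\<lambda>_. 1" unif01 "\<lambda>t. ennreal (time_density t)" half_line]
    by (simp add: time_law_density density_1 sigma_finite_half_line split_beta')
  then have "density (unif01 \<Otimes>\<^sub>M time_law) (\<lambda>z. \<rho> (fst z, F (snd z))) =
      density (unif01 \<Otimes>\<^sub>M half_line) (\<lambda>z. ennreal (time_density (snd z)) * \<rho> (fst z, F (snd z)))"
    using \<rho>F by (simp only:) (rule density_density_eq, measurable)
  also have "\<dots> = density (unif01 \<Otimes>\<^sub>M half_line) (\<lambda>z. ennreal (f (fst z) * exp (- f (fst z) * snd z)))"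
  proof (rule density_cong)
    \<comment> \<open>The density is set to zero on the boundary of the square. The labels \<open>0\<close> and \<open>1\<close> and the time
      \<open>0\<close>, which correspond to it, form null sets.\<close>
    have "AE u in lborel. u \<in> {0..1::real} \<longrightarrow> u \<noteq> 0 \<and> u \<noteq> 1"
      using AE_lborel_singleton[of 0] AE_lborel_singleton[of 1] by eventually_elim auto
    then have "AE u in unif01. u \<noteq> 0 \<and> u \<noteq> 1"
      unfolding unif01_def
      by (subst AE_restrict_space_iff) simp_all
    then have "AE z in unif01 \<Otimes>\<^sub>M half_line. (fst z \<noteq> 0 \<and> fst z \<noteq> 1) \<and> 0 < snd z"
    proof (intro UH.AE_pair_measure)
      assume ae: "AE u in unif01. u \<noteq> 0 \<and> u \<noteq> 1"
      show "AE u in unif01. AE t in half_line. (fst (u, t) \<noteq> 0 \<and> fst (u, t) \<noteq> 1) \<and> 0 < snd (u, t)"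
        using ae
      proof eventually_elim
        case (elim u)
        from AE_half_line_pos show ?case by eventually_elim (use elim in simp)
      qed
    qed measurable
    then show "AE z in unif01 \<Otimes>\<^sub>M half_line. ennreal (time_density (snd z)) * \<rho> (fst z, F (snd z)) =
        ennreal (f (fst z) * exp (- f (fst z) * snd z))"
      using AE_space
    proof eventually_elim
      case (elim z)
      then have u: "fst z \<in> {0<..<1}" and t: "0 < snd z"
        by (auto simp: space_pair_measure)
      have Ft: "0 < F (snd z)" "F (snd z) < 1"
        using F_strict_mono[of 0 "snd z"] F_less_1[of "snd z"] F_0 t by auto
      have "\<rho> (fst z, F (snd z)) = ennreal (f (fst z) * exp (- f (fst z) * snd z) / time_density (snd z))"
        using u t Ft by (simp add: luce_density_eq G_F)
      then show ?case
        using time_density_pos[OF t] pos[of "fst z"] u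
        by (simp flip: ennreal_mult)
    qed
  qed measurable
  finally show ?thesis by (simp add: arrival_density)
qed

lemma luce_permuton_arrival:
  "luce_permuton f = distr arrival (unif01 \<Otimes>\<^sub>M unif01) (\<lambda>z. (fst z, F (snd z)))"
proof -
  have [measurable]: "F \<in> half_line \<rightarrow>\<^sub>M unif01" by (rule F_measurable_half_line)
  show ?thesis
    unfolding arrival_def luce_permuton_def
    by (subst distr_distr[OF _ arrival_measurable])
       (auto intro!: distr_cong simp: sets_unif01_pair)
qed

text \<open>A density that factors through the map may be pulled out of an image measure, and the image of the
  product of the marginals is the uniform law on the square.\<close>

theorem luce_permuton_density: "luce_permuton f = density (restrict_space lborel square) \<rho>"
proof -
  have Fm [measurable]: "F \<in> time_law \<rightarrow>\<^sub>M unif01"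
    using F_measurable_half_line measurable_cong_sets[OF sets_time_law refl] by blast
  have "luce_permuton f = density (distr (unif01 \<Otimes>\<^sub>M time_law) (unif01 \<Otimes>\<^sub>M unif01) (\<lambda>z. (fst z, F (snd z)))) \<rho>"
    unfolding luce_permuton_arrival arrival_density_product
    by (rule density_distr[symmetric, OF luce_density_measurable]) measurable
  also have "distr (unif01 \<Otimes>\<^sub>M time_law) (unif01 \<Otimes>\<^sub>M unif01) (\<lambda>z. (fst z, F (snd z))) =
      distr unif01 unif01 (\<lambda>x. x) \<Otimes>\<^sub>M distr time_law unif01 F"
    using pair_measure_distr[of "\<lambda>x. x" unif01 unif01 F time_law unif01] F_time_law
      prob_space_imp_sigma_finite[OF prob_space_unif01] by (simp add: split_beta' Fm)
  also have "\<dots> = restrict_space lborel square"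
    by (simp add: F_time_law unif01_pair distr_id2)
  finally show ?thesis .
qed

theorem permuton_luce_permuton: "permuton (luce_permuton f)"
  unfolding permuton_def
proof (intro conjI)
  have [measurable]: "F \<in> half_line \<rightarrow>\<^sub>M unif01" by (rule F_measurable_half_line)
  have m [measurable]: "(\<lambda>z. (fst z, F (snd z))) \<in> arrival \<rightarrow>\<^sub>M unif01 \<Otimes>\<^sub>M unif01"
    unfolding arrival_def by measurable
  show "prob_space (luce_permuton f)"
    unfolding luce_permuton_arrival by (rule prob_space.prob_space_distr[OF prob_space_arrival m])
  show "sets (luce_permuton f) = sets (restrict_space borel square)"
    by (simp add: luce_permuton_def)
  have "distr (luce_permuton f) unif01 fst = distr arrival unif01 fst"
    unfolding luce_permuton_arrival by (subst distr_distr[OF _ m]) (auto simp: o_def)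
  also have "\<dots> = distr (unif01 \<Otimes>\<^sub>M expo1) unif01 fst"
    unfolding arrival_def by (subst distr_distr[OF _ arrival_measurable]) (auto simp: o_def)
  also have "\<dots> = unif01"
    by (rule E.distr_pair_fst)
  finally show "distr (luce_permuton f) unif01 fst = unif01" .
  have "distr (luce_permuton f) unif01 snd = distr time_law unif01 F"
    unfolding luce_permuton_arrival time_law_def
    by (subst distr_distr[OF _ m]) (auto simp: o_def distr_distr arrival_def)
  then show "distr (luce_permuton f) unif01 snd = unif01"
    by (simp add: F_time_law)
qed

end

section \<open>Ranks and sample permutations\<close>

lemma finite_perms: "finite (perms k)"
  by (simp add: perms_def finite_permutations)

lemma rank_less_iff:
  assumes "m \<in> {1..k}" "n \<in> {1..k}"
  shows "rank k a m < rank k a n \<longleftrightarrow> a m < a n"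
proof -
  have less: "rank k a m < rank k a n" if "a m < a n" "n \<in> {1..k}" for m n
    unfolding rank_def
  proof (rule psubset_card_mono)
    have "n \<in> {j \<in> {1..k}. a j \<le> a n}" "n \<notin> {j \<in> {1..k}. a j \<le> a m}"
      using that by auto
    moreover have "{j \<in> {1..k}. a j \<le> a m} \<subseteq> {j \<in> {1..k}. a j \<le> a n}"
      using that by auto
    ultimately show "{j \<in> {1..k}. a j \<le> a m} \<subset> {j \<in> {1..k}. a j \<le> a n}"
      by blast
  qed simp
  have le: "rank k a n \<le> rank k a m" if "a n \<le> a m" for m n
    unfolding rank_def by (rule card_mono) (use that in auto)
  show ?thesis
    using less[of m n] le[of n m] assms by (meson not_less)
qed

lemma rank_le_iff:
  assumes "m \<in> {1..k}" "n \<in> {1..k}"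
  shows "rank k a m \<le> rank k a n \<longleftrightarrow> a m \<le> a n"
  using rank_less_iff[of n k m a] assms by (simp add: not_less[symmetric])

lemma rank_in: "m \<in> {1..k} \<Longrightarrow> rank k a m \<in> {1..k}"
proof -
  assume m: "m \<in> {1..k}"
  then have "m \<in> {j \<in> {1..k}. a j \<le> a m}" by simp
  then have "rank k a m \<noteq> 0" unfolding rank_def by (subst card_0_eq) auto
  moreover have "rank k a m \<le> card {1..k}" unfolding rank_def by (rule card_mono) auto
  ultimately show ?thesis by simp
qed

lemma rank_bij_betw:
  assumes "inj_on a {1..k}" shows "bij_betw (rank k a) {1..k} {1..k}"
proof -
  have "inj_on (rank k a) {1..k}"
    using assms by (intro inj_onI) (metis inj_onD order.eq_iff rank_le_iff)
  then show ?thesis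
    using rank_in[of _ k a] by (simp add: bij_betw_def endo_inj_surj image_subset_iff)
qed

text \<open>If \<open>s\<close> lists the indices in the order of increasing values, the \<open>i\<close>-th one has rank \<open>i\<close>.\<close>

lemma rank_strict_mono:
  assumes s: "s permutes {1..k}" and mono: "strict_mono_on {1..k} (\<lambda>i. a (s i))" and i: "i \<in> {1..k}"
  shows "rank k a (s i) = i"
proof -
  have "{j \<in> {1..k}. a j \<le> a (s i)} = s ` {1..i}"
  proof (intro equalityI subsetI)
    fix j assume j: "j \<in> {j \<in> {1..k}. a j \<le> a (s i)}"
    then obtain l where l: "l \<in> {1..k}" "j = s l"
      using permutes_image[OF s] by blast
    have "l \<le> i"
      using j l i strict_mono_onD[OF mono, of i l] by (auto simp: not_less[symmetric])
    with l show "j \<in> s ` {1..i}" by auto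
  next
    fix j assume "j \<in> s ` {1..i}"
    then obtain l where l: "l \<in> {1..i}" "j = s l" by blast
    then have "l \<in> {1..k}" using i by auto
    moreover have "a (s l) \<le> a (s i)"
      using strict_mono_onD[OF mono, of l i] l i by (cases "l = i") (auto simp: less_imp_le)
    ultimately show "j \<in> {j \<in> {1..k}. a j \<le> a (s i)}"
      using l permutes_in_image[OF s] by simp
  qed
  then show ?thesis
    using card_image[OF inj_on_subset[OF permutes_inj[OF s] subset_UNIV]] by (simp add: rank_def)
qed

lemma sorting_permutation:
  assumes a: "inj_on (a :: nat \<Rightarrow> real) {1..k}"
  obtains \<tau> where "\<tau> permutes {1..k}" "strict_mono_on {1..k} (\<lambda>i. a (\<tau> i))"
proof -
  define \<tau> where "\<tau> i = (if i \<in> {1..k} then the_inv_into {1..k} (rank k a) i else i)" for i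
  note bij = rank_bij_betw[OF a]
  have "bij_betw \<tau> {1..k} {1..k}"
    using bij_betw_the_inv_into[OF bij] by (rule bij_betw_cong[THEN iffD1, rotated]) (simp add: \<tau>_def)
  then have p: "\<tau> permutes {1..k}"
    by (rule bij_imp_permutes) (auto simp: \<tau>_def)
  have r: "rank k a (\<tau> i) = i" if "i \<in> {1..k}" for i
    using f_the_inv_into_f_bij_betw[OF bij] that by (simp add: \<tau>_def)
  have "strict_mono_on {1..k} (\<lambda>i. a (\<tau> i))"
  proof (rule strict_mono_onI)
    fix i j :: nat assume "i \<in> {1..k}" "j \<in> {1..k}" "i < j"
    then show "a (\<tau> i) < a (\<tau> j)"
      using rank_less_iff[of "\<tau> i" k "\<tau> j" a] r permutes_in_image[OF p] by simp
  qed
  with p show thesis by (rule that)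
qed

lemma order_stat_eq:
  assumes \<tau>: "\<tau> permutes {1..k}" and mono: "strict_mono_on {1..k} (\<lambda>i. u (\<tau> i))" and i: "i \<in> {1..k}"
  shows "order_stat k u i = u (\<tau> i)"
proof -
  have set: "set [1..<Suc k] = {1..k}" by auto
  have "sort (map u [1..<Suc k]) = map (\<lambda>i. u (\<tau> i)) [1..<Suc k]"
  proof (rule properties_for_sort)
    have "image_mset \<tau> (mset_set {1..k}) = mset_set {1..k}"
      using image_mset_mset_set[OF inj_on_subset[OF permutes_inj[OF \<tau>] subset_UNIV]] permutes_image[OF \<tau>]
      by metis
    then have "image_mset (u \<circ> \<tau>) (mset_set {1..k}) = image_mset u (mset_set {1..k})"
      by (metis multiset.map_comp)
    moreover have "mset [1..<Suc k] = mset_set {1..k}"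
      using mset_set_set[of "[1..<Suc k]"] set by simp
    ultimately show "mset (map (\<lambda>i. u (\<tau> i)) [1..<Suc k]) = mset (map u [1..<Suc k])"
      by (simp only: mset_map o_def)
    show "sorted (map (\<lambda>i. u (\<tau> i)) [1..<Suc k])"
    proof (subst sorted_iff_nth_mono, intro allI impI)
      fix p q assume pq: "p \<le> q" "q < length (map (\<lambda>i. u (\<tau> i)) [1..<Suc k])"
      then have "p = q \<or> u (\<tau> (Suc p)) < u (\<tau> (Suc q))"
        using strict_mono_onD[OF mono, of "Suc p" "Suc q"] by (cases "p = q") (auto simp del: upt_Suc)
      then show "map (\<lambda>i. u (\<tau> i)) [1..<Suc k] ! p \<le> map (\<lambda>i. u (\<tau> i)) [1..<Suc k] ! q"
        using pq by (auto simp del: upt_Suc)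
    qed
  qed
  then show ?thesis
    using i by (cases i) (auto simp: order_stat_def simp del: upt_Suc)
qed

lemma perm_of_points_rank:
  assumes x: "inj_on (\<lambda>m. fst (z m)) {1..k}" and y: "inj_on (\<lambda>m. snd (z m)) {1..k}" and m: "m \<in> {1..k}"
  shows "perm_of_points k z (rank k (\<lambda>m. fst (z m)) m) = rank k (\<lambda>m. snd (z m)) m"
  using rank_in[OF m] the_inv_into_f_f[OF bij_betw_imp_inj_on[OF rank_bij_betw[OF x]] m] x y
  by (simp add: perm_of_points_def)

lemma perm_of_points_in_perms: "perm_of_points k z \<in> perms k"
proof (cases "inj_on (\<lambda>m. fst (z m)) {1..k} \<and> inj_on (\<lambda>m. snd (z m)) {1..k}")
  case True
  then have "bij_betw (rank k (\<lambda>m. snd (z m)) \<circ> the_inv_into {1..k} (rank k (\<lambda>m. fst (z m)))) {1..k} {1..k}"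
    by (intro bij_betw_trans[of _ _ "{1..k}"] bij_betw_the_inv_into rank_bij_betw) auto
  then have "bij_betw (perm_of_points k z) {1..k} {1..k}"
    by (rule bij_betw_cong[THEN iffD1, rotated]) (use True in \<open>simp add: perm_of_points_def\<close>)
  then have "perm_of_points k z permutes {1..k}"
    by (rule bij_imp_permutes) (use True in \<open>auto simp add: perm_of_points_def\<close>)
  then show ?thesis by (simp add: perms_def)
next
  case False
  then show ?thesis by (auto simp: perm_of_points_def perms_def permutes_id)
qed

text \<open>Without ties, the sampled permutation maps the horizontal rank of each point to its vertical rank; this
  form avoids the inverse of the rank function.\<close>

lemma perm_of_points_eq_iff:
  assumes x: "inj_on (\<lambda>m. fst (z m)) {1..k}" and y: "inj_on (\<lambda>m. snd (z m)) {1..k}" and \<pi>: "\<pi> \<in> perms k"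
  shows "perm_of_points k z = \<pi> \<longleftrightarrow>
    (\<forall>m\<in>{1..k}. \<pi> (rank k (\<lambda>m. fst (z m)) m) = rank k (\<lambda>m. snd (z m)) m)"
proof
  assume "perm_of_points k z = \<pi>"
  then show "\<forall>m\<in>{1..k}. \<pi> (rank k (\<lambda>m. fst (z m)) m) = rank k (\<lambda>m. snd (z m)) m"
    using perm_of_points_rank[OF x y] by auto
next
  assume *: "\<forall>m\<in>{1..k}. \<pi> (rank k (\<lambda>m. fst (z m)) m) = rank k (\<lambda>m. snd (z m)) m"
  show "perm_of_points k z = \<pi>"
  proof
    fix i
    show "perm_of_points k z i = \<pi> i"
    proof (cases "i \<in> {1..k}")
      case True
      then obtain m where "m \<in> {1..k}" "i = rank k (\<lambda>m. fst (z m)) m"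
        using bij_betw_imp_surj_on[OF rank_bij_betw[OF x]] by blast
      with * perm_of_points_rank[OF x y] show ?thesis by simp
    next
      case False
      then show ?thesis
        using \<pi> perm_of_points_in_perms[of k z] by (auto simp: perms_def permutes_not_in)
    qed
  qed
qed

text \<open>Let \<open>\<tau>\<close> list the points from left to right. The pattern \<open>\<pi>\<close> says that the point at horizontal
  position \<open>inv \<pi> j\<close> has height rank \<open>j\<close>, so it occurs if and only if listing the points in the order
  \<open>\<tau> (inv \<pi> 1), \<tau> (inv \<pi> 2), \<dots>\<close> is listing them by increasing height.\<close>

lemma perm_of_points_eq_iff_chain:
  assumes \<tau>: "\<tau> permutes {1..k}" "strict_mono_on {1..k} (\<lambda>i. fst (z (\<tau> i)))"
    and y: "inj_on (\<lambda>m. snd (z m)) {1..k}" and \<pi>: "\<pi> \<in> perms k"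
  shows "perm_of_points k z = \<pi> \<longleftrightarrow> strict_mono_on {1..k} (\<lambda>j. snd (z (\<tau> (inv \<pi> j))))"
proof -
  have \<pi>': "\<pi> permutes {1..k}" using \<pi> by (simp add: perms_def)
  have s: "(\<tau> \<circ> inv \<pi>) permutes {1..k}"
    by (intro permutes_compose permutes_inv \<pi>' \<tau>)
  have x: "inj_on (\<lambda>m. fst (z m)) {1..k}"
  proof -
    have "inj_on ((\<lambda>m. fst (z m)) \<circ> \<tau>) {1..k}"
      using strict_mono_on_imp_inj_on[OF \<tau>(2)] by (simp add: o_def)
    then show ?thesis
      using inj_on_imageI[of "\<lambda>m. fst (z m)" \<tau> "{1..k}"] permutes_image[OF \<tau>(1)] by simp
  qed
  have rx: "rank k (\<lambda>m. fst (z m)) (\<tau> i) = i" if "i \<in> {1..k}" for i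
    by (rule rank_strict_mono[OF \<tau>(1) _ that]) (rule \<tau>(2))
  have img: "{1..k} = (\<lambda>j. \<tau> (inv \<pi> j)) ` {1..k}"
    using permutes_image[OF s] by (simp add: o_def)
  have "perm_of_points k z = \<pi> \<longleftrightarrow>
      (\<forall>j\<in>{1..k}. \<pi> (rank k (\<lambda>m. fst (z m)) (\<tau> (inv \<pi> j))) = rank k (\<lambda>m. snd (z m)) (\<tau> (inv \<pi> j)))"
    unfolding perm_of_points_eq_iff[OF x y \<pi>] by (subst img) auto
  also have "\<dots> \<longleftrightarrow> (\<forall>j\<in>{1..k}. rank k (\<lambda>m. snd (z m)) (\<tau> (inv \<pi> j)) = j)"
    using rx permutes_in_image[OF permutes_inv[OF \<pi>']] permutes_inverses(1)[OF \<pi>'] by auto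
  also have "\<dots> \<longleftrightarrow> strict_mono_on {1..k} (\<lambda>j. snd (z (\<tau> (inv \<pi> j))))"
  proof
    assume *: "\<forall>j\<in>{1..k}. rank k (\<lambda>m. snd (z m)) (\<tau> (inv \<pi> j)) = j"
    show "strict_mono_on {1..k} (\<lambda>j. snd (z (\<tau> (inv \<pi> j))))"
    proof (rule strict_mono_onI)
      fix i j assume ij: "i \<in> {1..k}" "j \<in> {1..k}" "i < j"
      then have "\<tau> (inv \<pi> i) \<in> {1..k}" "\<tau> (inv \<pi> j) \<in> {1..k}"
        using permutes_in_image[OF s] by (simp_all add: o_def)
      with ij * show "snd (z (\<tau> (inv \<pi> i))) < snd (z (\<tau> (inv \<pi> j)))"
        using rank_less_iff[of "\<tau> (inv \<pi> i)" k "\<tau> (inv \<pi> j)" "\<lambda>m. snd (z m)"] by simp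
    qed
  next
    assume *: "strict_mono_on {1..k} (\<lambda>j. snd (z (\<tau> (inv \<pi> j))))"
    show "\<forall>j\<in>{1..k}. rank k (\<lambda>m. snd (z m)) (\<tau> (inv \<pi> j)) = j"
      using rank_strict_mono[OF s, of "\<lambda>m. snd (z m)"] * by (simp add: o_def)
  qed
  finally show ?thesis .
qed

lemma perm_of_points_measurable:
  assumes [measurable]: "fst \<in> borel_measurable M" "snd \<in> borel_measurable M"
  shows "perm_of_points k \<in> Pi\<^sub>M {1..k} (\<lambda>_. M) \<rightarrow>\<^sub>M count_space (perms k)"
proof (subst measurable_count_space_eq2[OF finite_perms], intro conjI ballI)
  let ?P = "Pi\<^sub>M {1..k} (\<lambda>_. M)"
  show "perm_of_points k \<in> space ?P \<rightarrow> perms k"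
    using perm_of_points_in_perms by auto
  fix \<pi> assume \<pi>: "\<pi> \<in> perms k"
  have x [measurable]: "(\<lambda>z. fst (z m)) \<in> borel_measurable ?P" if "m \<in> {1..k}" for m
    using that by measurable
  have y [measurable]: "(\<lambda>z. snd (z m)) \<in> borel_measurable ?P" if "m \<in> {1..k}" for m
    using that by measurable
  have r: "(\<lambda>z. rank k (\<lambda>m. g (z m)) m) \<in> ?P \<rightarrow>\<^sub>M count_space UNIV"
    if g: "\<And>m. m \<in> {1..k} \<Longrightarrow> (\<lambda>z. g (z m)) \<in> borel_measurable ?P" and m: "m \<in> {1..k}"
    for m and g :: "real \<times> real \<Rightarrow> real"
    unfolding rank_def
  proof (rule measurable_card)
    fix i
    have "Measurable.pred ?P (\<lambda>z. g (z i) \<le> g (z m))" if "i \<in> {1..k}"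
      unfolding pred_def by (intro borel_measurable_le g m that)
    then show "{z \<in> space ?P. i \<in> {j \<in> {1..k}. g (z j) \<le> g (z m)}} \<in> sets ?P"
      by (cases "i \<in> {1..k}") (simp_all add: pred_def)
  qed
  note rx [measurable] = r[of fst, OF x] and ry [measurable] = r[of snd, OF y]
  have [measurable]: "Measurable.pred ?P (\<lambda>z. fst (z i) = fst (z j))"
    "Measurable.pred ?P (\<lambda>z. snd (z i) = snd (z j))" if "i \<in> {1..k}" "j \<in> {1..k}" for i j
    unfolding pred_def by (intro borel_measurable_eq x y that)+
  have inj [measurable]: "Measurable.pred ?P (\<lambda>z. inj_on (\<lambda>m. fst (z m)) {1..k} \<and> inj_on (\<lambda>m. snd (z m)) {1..k})"
    unfolding inj_on_def by measurable
  have eq [measurable]: "Measurable.pred ?P (\<lambda>z. \<forall>m\<in>{1..k}. \<pi> (rank k (\<lambda>m. fst (z m)) m) = rank k (\<lambda>m. snd (z m)) m)"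
    by measurable
  have "perm_of_points k -` {\<pi>} \<inter> space ?P = {z \<in> space ?P.
      if inj_on (\<lambda>m. fst (z m)) {1..k} \<and> inj_on (\<lambda>m. snd (z m)) {1..k}
      then \<forall>m\<in>{1..k}. \<pi> (rank k (\<lambda>m. fst (z m)) m) = rank k (\<lambda>m. snd (z m)) m
      else \<pi> = id}"
  proof -
    have "perm_of_points k z = \<pi> \<longleftrightarrow>
        (if inj_on (\<lambda>m. fst (z m)) {1..k} \<and> inj_on (\<lambda>m. snd (z m)) {1..k}
         then \<forall>m\<in>{1..k}. \<pi> (rank k (\<lambda>m. fst (z m)) m) = rank k (\<lambda>m. snd (z m)) m
         else \<pi> = id)" for z
      using perm_of_points_eq_iff[OF _ _ \<pi>, of z]
      by (cases "inj_on (\<lambda>m. fst (z m)) {1..k} \<and> inj_on (\<lambda>m. snd (z m)) {1..k}")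
         (simp, auto simp: perm_of_points_def)
    note * = this
    show ?thesis
      by (intro set_eqI) (simp only: Int_iff vimage_eq singleton_iff mem_Collect_eq * conj_commute)
  qed
  also have "\<dots> \<in> sets ?P"
    by measurable
  finally show "perm_of_points k -` {\<pi>} \<inter> space ?P \<in> sets ?P" .
qed

section \<open>The exponential race\<close>

text \<open>Sampling independent pairs is the same as sampling the two families of components independently: on
  boxes, both sides are iterated integrals of a product over the indices.\<close>

lemma PiM_pair_measure:
  assumes fin: "finite I" and M: "prob_space M" and N: "prob_space N"
  shows "distr (PiM I (\<lambda>_. M) \<Otimes>\<^sub>M PiM I (\<lambda>_. N)) (PiM I (\<lambda>_. M \<Otimes>\<^sub>M N)) (\<lambda>z. \<lambda>i\<in>I. (fst z i, snd z i)) =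
    PiM I (\<lambda>_. M \<Otimes>\<^sub>M N)" (is "?D = ?P")
proof -
  interpret M: prob_space M by fact
  interpret N: prob_space N by fact
  interpret MN: pair_prob_space M N ..
  interpret PM: product_prob_space "\<lambda>_. M" by (rule product_prob_spaceI) (rule M)
  interpret PN: product_prob_space "\<lambda>_. N" by (rule product_prob_spaceI) (rule N)
  interpret PMN: product_prob_space "\<lambda>_. M \<Otimes>\<^sub>M N" by (rule product_prob_spaceI) (rule MN.prob_space_axioms)
  have PNI: "sigma_finite_measure (PiM I (\<lambda>_. N))"
    by (intro prob_space_imp_sigma_finite prob_space_PiM) (rule N)
  have m: "(\<lambda>z. \<lambda>i\<in>I. (fst z i, snd z i)) \<in> PiM I (\<lambda>_. M) \<Otimes>\<^sub>M PiM I (\<lambda>_. N) \<rightarrow>\<^sub>M ?P"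
    by measurable
  show ?thesis
  proof (rule PMN.PiM_eqI[OF fin])
    fix A assume A: "\<And>i. i \<in> I \<Longrightarrow> A i \<in> sets (M \<Otimes>\<^sub>M N)"
    have PA: "Pi\<^sub>E I A \<in> sets ?P" using A fin by (intro sets_PiM_I_finite) auto
    have "emeasure ?D (Pi\<^sub>E I A) = (\<integral>\<^sup>+z. indicator (Pi\<^sub>E I A) z \<partial>?D)"
      using PA by (subst nn_integral_indicator) auto
    also have "\<dots> = (\<integral>\<^sup>+z. indicator (Pi\<^sub>E I A) (\<lambda>i\<in>I. (fst z i, snd z i)) \<partial>(PiM I (\<lambda>_. M) \<Otimes>\<^sub>M PiM I (\<lambda>_. N)))"
      using PA by (subst nn_integral_distr[OF m]) auto
    also have "\<dots> = (\<integral>\<^sup>+u. (\<integral>\<^sup>+e. indicator (Pi\<^sub>E I A) (\<lambda>i\<in>I. (u i, e i)) \<partial>PiM I (\<lambda>_. N)) \<partial>PiM I (\<lambda>_. M))"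
      using PA by (subst sigma_finite_measure.nn_integral_fst[OF PNI, symmetric]) (auto intro!: measurable_compose[OF m])
    also have "\<dots> = (\<integral>\<^sup>+u. (\<integral>\<^sup>+e. (\<Prod>i\<in>I. indicator (A i) (u i, e i)) \<partial>PiM I (\<lambda>_. N)) \<partial>PiM I (\<lambda>_. M))"
    proof (intro nn_integral_cong)
      fix u e
      show "indicator (Pi\<^sub>E I A) (\<lambda>i\<in>I. (u i, e i)) = (\<Prod>i\<in>I. indicator (A i) (u i, e i) :: ennreal)"
        using fin by (auto simp: indicator_def PiE_iff)
    qed
    also have "\<dots> = (\<integral>\<^sup>+u. (\<Prod>i\<in>I. \<integral>\<^sup>+e. indicator (A i) (u i, e) \<partial>N) \<partial>PiM I (\<lambda>_. M))"
    proof (intro nn_integral_cong PN.product_nn_integral_prod[OF fin])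
      fix u i assume "u \<in> space (PiM I (\<lambda>_. M))" and i: "i \<in> I"
      then have [measurable]: "u i \<in> space M" "A i \<in> sets (M \<Otimes>\<^sub>M N)" using A by (auto simp: space_PiM)
      show "(\<lambda>e. indicator (A i) (u i, e) :: ennreal) \<in> borel_measurable N" by measurable
    qed
    also have "\<dots> = (\<Prod>i\<in>I. \<integral>\<^sup>+u. (\<integral>\<^sup>+e. indicator (A i) (u, e) \<partial>N) \<partial>M)"
    proof (intro PM.product_nn_integral_prod[OF fin])
      fix i assume i: "i \<in> I"
      then show "(\<lambda>u. \<integral>\<^sup>+e. indicator (A i) (u, e) \<partial>N) \<in> borel_measurable M"
        using A[OF i] by measurable
    qed
    also have "\<dots> = (\<Prod>i\<in>I. emeasure (M \<Otimes>\<^sub>M N) (A i))"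
      using A by (intro prod.cong refl) (subst N.nn_integral_fst, auto)
    finally show "emeasure ?D (Pi\<^sub>E I A) = \<dots>" .
  qed simp
qed

lemma nn_integral_exp_tail:
  fixes a q :: real
  assumes "0 \<le> a" "0 < q"
  shows "(\<integral>\<^sup>+t. ennreal (exp (- q * t)) * indicator {a<..} t \<partial>half_line) = ennreal (exp (- q * a) / q)"
proof -
  have "(\<integral>\<^sup>+t. ennreal (exp (- q * t)) * indicator {a<..} t \<partial>half_line) =
      (\<integral>\<^sup>+t. ennreal (exp (- q * t)) * indicator {a..} t \<partial>lborel)"
    using assms AE_lborel_singleton[of a] unfolding half_line_def
    by (subst nn_integral_restrict_space) (auto intro!: nn_integral_cong_AE simp: indicator_def)
  also have "\<dots> = ennreal (0 - (- exp (- q * a) / q))"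
  proof (rule nn_integral_FTC_atLeast)
    have "LIM t at_top. - q * t :> at_bot"
      using assms by (intro filterlim_tendsto_neg_mult_at_bot[OF tendsto_const]) (auto simp: filterlim_ident)
    from tendsto_divide[OF tendsto_minus[OF filterlim_compose[OF exp_at_bot this]] tendsto_const[of q]]
    show "((\<lambda>t. - exp (- q * t) / q) \<longlongrightarrow> 0) at_top" using assms by simp
  qed (use assms in \<open>auto intro!: derivative_eq_intros\<close>)
  finally show ?thesis by simp
qed

lemma sorted_wrt_measurable:
  fixes T :: "'a \<Rightarrow> 'i \<Rightarrow> real"
  assumes "\<And>i. i \<in> set xs \<Longrightarrow> (\<lambda>\<omega>. T \<omega> i) \<in> borel_measurable M" and "g \<in> borel_measurable M"
  shows "Measurable.pred M (\<lambda>\<omega>. sorted_wrt (<) (g \<omega> # map (T \<omega>) xs))"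
  using assms
proof (induction xs arbitrary: g)
  case (Cons i xs)
  have "Measurable.pred M (\<lambda>\<omega>. sorted_wrt (<) (T \<omega> i # map (T \<omega>) xs))"
    using Cons.prems by (intro Cons.IH) auto
  moreover have "Measurable.pred M (\<lambda>\<omega>. g \<omega> < T \<omega> i)"
    unfolding pred_def using Cons.prems by (intro borel_measurable_less) auto
  ultimately have "Measurable.pred M (\<lambda>\<omega>. g \<omega> < T \<omega> i \<and> sorted_wrt (<) (T \<omega> i # map (T \<omega>) xs))"
    by (auto intro: pred_intros_logic)
  then show ?case
    by (simp only: list.map sorted_wrt2[OF transp_on_less])
qed simp

text \<open>The first clock of the list has to ring after time \<open>a\<close> and before all the others. Given that it rings at
  time \<open>t\<close>, the remaining clocks run the same race from time \<open>t\<close> on, and by induction the probability of the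
  right outcome is a constant times \<open>exp (- t * S)\<close>, with \<open>S\<close> the total rate of the remaining clocks.
  Integrating over \<open>t\<close> yields the factor \<open>r x / (r x + S)\<close>. Carrying the starting time \<open>a\<close> along is what
  makes the induction work.\<close>

lemma exponential_race:
  assumes "distinct xs" "\<And>i. i \<in> set xs \<Longrightarrow> 0 < r i" "0 \<le> a"
  shows "(\<integral>\<^sup>+e. indicator {e. sorted_wrt (<) (a # map (\<lambda>i. e i / r i) xs)} e \<partial>PiM (set xs) (\<lambda>_. expo1)) =
    ennreal (exp (- a * sum_list (map r xs)) * (\<Prod>i<length xs. r (xs ! i) / sum_list (map r (drop i xs))))"
  using assms
proof (induction xs arbitrary: a)
  case Nil
  interpret product_prob_space "\<lambda>_. expo1" by (rule product_prob_spaceI) (rule prob_space_expo1)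
  show ?case by (simp add: PiM_empty nn_integral_count_space_finite)
next
  case (Cons x xs)
  interpret product_prob_space "\<lambda>_. expo1" by (rule product_prob_spaceI) (rule prob_space_expo1)
  define S where "S = sum_list (map r xs)"
  define L where "L = (\<Prod>i<length xs. r (xs ! i) / sum_list (map r (drop i xs)))"
  have r: "0 < r x" and rs: "\<And>i. i \<in> set xs \<Longrightarrow> 0 < r i" and x: "x \<notin> set xs"
    using Cons.prems by auto
  have S: "0 \<le> S" unfolding S_def using rs by (intro sum_list_nonneg) (auto intro: less_imp_le)
  have L: "0 \<le> L" unfolding L_def using rs
    by (intro prod_nonneg ballI divide_nonneg_nonneg sum_list_nonneg)
       (auto intro!: less_imp_le dest!: in_set_dropD)
  let ?ind = "\<lambda>e. indicator {e. sorted_wrt (<) (a # map (\<lambda>i. e i / r i) (x # xs))} e :: ennreal"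
  have comp: "(\<lambda>e. e i / r i) \<in> borel_measurable (PiM J (\<lambda>_. expo1))" if "i \<in> J" for i J
    using measurable_compose[OF measurable_component_singleton[OF that] id_measurable_expo1] by simp
  have m: "?ind \<in> borel_measurable (PiM (insert x (set xs)) (\<lambda>_. expo1))"
  proof -
    have "Measurable.pred (PiM (insert x (set xs)) (\<lambda>_. expo1))
        (\<lambda>e. sorted_wrt (<) (a # map (\<lambda>i. e i / r i) (x # xs)))"
      by (rule sorted_wrt_measurable) (auto intro!: comp)
    then show ?thesis unfolding indicator_def by (simp del: sorted_wrt.simps list.map) 
  qed
  have "(\<integral>\<^sup>+e. ?ind e \<partial>PiM (insert x (set xs)) (\<lambda>_. expo1)) =
      (\<integral>\<^sup>+y. (\<integral>\<^sup>+e. ?ind (e(x := y)) \<partial>PiM (set xs) (\<lambda>_. expo1)) \<partial>expo1)"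
    by (rule product_nn_integral_insert_rev[OF _ x m]) simp
  also have "\<dots> = (\<integral>\<^sup>+y. indicator {a<..} (y / r x) * ennreal (exp (- (y / r x) * S) * L) \<partial>expo1)"
  proof (rule nn_integral_cong)
    fix y assume "y \<in> space expo1"
    then have y: "0 \<le> y / r x" using r by simp
    have "(\<integral>\<^sup>+e. ?ind (e(x := y)) \<partial>PiM (set xs) (\<lambda>_. expo1)) =
        (\<integral>\<^sup>+e. indicator {a<..} (y / r x) *
          indicator {e. sorted_wrt (<) (y / r x # map (\<lambda>i. e i / r i) xs)} e \<partial>PiM (set xs) (\<lambda>_. expo1))"
    proof (rule nn_integral_cong)
      fix e :: "'a \<Rightarrow> real"
      have "map (\<lambda>i. (e(x := y)) i / r i) (x # xs) = y / r x # map (\<lambda>i. e i / r i) xs"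
        using x by auto
      then show "?ind (e(x := y)) = indicator {a<..} (y / r x) *
          indicator {e. sorted_wrt (<) (y / r x # map (\<lambda>i. e i / r i) xs)} e"
        by (simp only: indicator_def mem_Collect_eq sorted_wrt2[OF transp_on_less]) auto
    qed
    also have "\<dots> = indicator {a<..} (y / r x) *
        (\<integral>\<^sup>+e. indicator {e. sorted_wrt (<) (y / r x # map (\<lambda>i. e i / r i) xs)} e \<partial>PiM (set xs) (\<lambda>_. expo1))"
      by (cases "y / r x \<in> {a<..}") simp_all
    also have "(\<integral>\<^sup>+e. indicator {e. sorted_wrt (<) (y / r x # map (\<lambda>i. e i / r i) xs)} e \<partial>PiM (set xs) (\<lambda>_. expo1)) =
        ennreal (exp (- (y / r x) * S) * L)"
      unfolding S_def L_def using Cons.prems y by (intro Cons.IH) auto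
    finally show "(\<integral>\<^sup>+e. ?ind (e(x := y)) \<partial>PiM (set xs) (\<lambda>_. expo1)) =
        indicator {a<..} (y / r x) * ennreal (exp (- (y / r x) * S) * L)" .
  qed
  also have "\<dots> = (\<integral>\<^sup>+t. ennreal (r x * exp (- r x * t)) *
      (indicator {a<..} t * ennreal (exp (- t * S) * L)) \<partial>half_line)"
    by (rule nn_integral_expo1_rate[OF r]) measurable
  also have "\<dots> = (\<integral>\<^sup>+t. ennreal (r x * L) * (ennreal (exp (- (r x + S) * t)) * indicator {a<..} t) \<partial>half_line)"
  proof (rule nn_integral_cong)
    fix t :: real
    have "r x * exp (- r x * t) * (exp (- t * S) * L) = r x * L * exp (- (r x + S) * t)"
      by (simp add: exp_add[symmetric] algebra_simps)
    then show "ennreal (r x * exp (- r x * t)) * (indicator {a<..} t * ennreal (exp (- t * S) * L)) =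
        ennreal (r x * L) * (ennreal (exp (- (r x + S) * t)) * indicator {a<..} t)"
      using r L by (auto simp: indicator_def simp flip: ennreal_mult)
  qed
  also have "\<dots> = ennreal (r x * L) * ennreal (exp (- (r x + S) * a) / (r x + S))"
  proof -
    have [measurable]: "(indicator {a<..} :: real \<Rightarrow> ennreal) \<in> borel_measurable half_line"
      by (rule measurable_compose[OF id_measurable_half_line]) simp
    have "0 \<le> a" "0 < r x + S" using Cons.prems(3) r S by linarith+
    note tail = nn_integral_exp_tail[OF this]
    show ?thesis by (subst nn_integral_cmult, measurable) (simp only: tail)
  qed
  also have "\<dots> = ennreal (exp (- a * (r x + S)) * (r x / (r x + S) * L))"
  proof -
    have "r x * L * (exp (- (r x + S) * a) / (r x + S)) = exp (- a * (r x + S)) * (r x / (r x + S) * L)"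
      by (simp add: algebra_simps)
    then show ?thesis using r L S by (simp flip: ennreal_mult)
  qed
  also have "\<dots> = ennreal (exp (- a * sum_list (map r (x # xs))) *
      (\<Prod>i<length (x # xs). r ((x # xs) ! i) / sum_list (map r (drop i (x # xs)))))"
    by (simp add: S_def L_def prod.lessThan_Suc_shift del: prod.lessThan_Suc)
  finally show ?case by simp
qed

text \<open>The denominators of the Luce product are the total rates of the clocks that have not rung yet.\<close>

lemma luce_p_list:
  "(\<Prod>i<k. r (map s [1..<Suc k] ! i) / sum_list (map r (drop i (map s [1..<Suc k])))) = luce_p k (\<lambda>i. r (s i))"
proof -
  have "luce_p k (\<lambda>i. r (s i)) =
      (\<Prod>i<k. r (s (Suc i)) / ((\<Sum>j = 1..k. r (s j)) - (\<Sum>j = 1..<Suc i. r (s j))))"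
    unfolding luce_p_def
    by (rule prod.reindex_bij_witness[where j = "\<lambda>i. i - 1" and i = Suc]) auto
  also have "\<dots> = (\<Prod>i<k. r (map s [1..<Suc k] ! i) / sum_list (map r (drop i (map s [1..<Suc k]))))"
  proof (intro prod.cong refl)
    fix i assume i: "i \<in> {..<k}"
    have "{1..k} = {1..<Suc i} \<union> {Suc i..<Suc k}" "{1..<Suc i} \<inter> {Suc i..<Suc k} = {}"
      using i by auto
    then have "(\<Sum>j = 1..k. r (s j)) = (\<Sum>j = 1..<Suc i. r (s j)) + (\<Sum>j = Suc i..<Suc k. r (s j))"
      by (simp add: sum.union_disjoint)
    moreover have "sum_list (map r (drop i (map s [1..<Suc k]))) = (\<Sum>j = Suc i..<Suc k. r (s j))"
      by (simp add: drop_map drop_upt sum_list_distinct_conv_sum_set o_def del: upt_Suc)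
    ultimately show "r (s (Suc i)) / ((\<Sum>j = 1..k. r (s j)) - (\<Sum>j = 1..<Suc i. r (s j))) =
        r (map s [1..<Suc k] ! i) / sum_list (map r (drop i (map s [1..<Suc k])))"
      using i by (simp del: upt_Suc)
  qed
  finally show ?thesis ..
qed

lemma strict_mono_on_iff_sorted_wrt:
  "strict_mono_on {1..k} (\<lambda>j. T (s j)) \<longleftrightarrow> sorted_wrt (<) (map T (map s [1..<Suc k]))"
proof
  assume "strict_mono_on {1..k} (\<lambda>j. T (s j))"
  then show "sorted_wrt (<) (map T (map s [1..<Suc k]))"
    by (auto simp: sorted_wrt_iff_nth_less strict_mono_on_def simp del: upt_Suc)
next
  assume *: "sorted_wrt (<) (map T (map s [1..<Suc k]))"
  show "strict_mono_on {1..k} (\<lambda>j. T (s j))"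
  proof (rule strict_mono_onI)
    fix i j assume "i \<in> {1..k}" "j \<in> {1..k}" "i < j"
    then show "T (s i) < T (s j)"
      using sorted_wrt_nth_less[OF *, of "i - 1" "j - 1"] by (simp del: upt_Suc)
  qed
qed

section \<open>Pattern densities of the Luce permuton\<close>

text \<open>The usual description of order statistics by counting, from which their measurability follows.\<close>

lemma order_stat_le_iff:
  assumes i: "i \<in> {1..k}"
  shows "order_stat k u i \<le> c \<longleftrightarrow> i \<le> card {m \<in> {1..k}. u m \<le> c}"
proof -
  define xs where "xs = sort (map u [1..<Suc k])"
  have len: "length xs = k" by (simp add: xs_def del: upt_Suc)
  have sorted: "sorted xs" by (simp add: xs_def)
  have "card {m \<in> {1..k}. u m \<le> c} = length (filter (\<lambda>m. u m \<le> c) [1..<Suc k])"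
    by (subst distinct_card[symmetric]) (auto intro!: arg_cong[where f = card] simp del: upt_Suc)
  also have "\<dots> = length (filter (\<lambda>x. x \<le> c) (map u [1..<Suc k]))"
    by (simp add: filter_map o_def del: upt_Suc)
  also have "\<dots> = length (filter (\<lambda>x. x \<le> c) xs)"
    unfolding xs_def by (metis mset_filter mset_sort size_mset)
  also have "\<dots> = card {j. j < k \<and> xs ! j \<le> c}"
    by (simp add: length_filter_conv_card len)
  finally have card: "card {m \<in> {1..k}. u m \<le> c} = card {j. j < k \<and> xs ! j \<le> c}" .
  have "xs ! (i - 1) \<le> c \<longleftrightarrow> i \<le> card {j. j < k \<and> xs ! j \<le> c}"
  proof
    assume *: "xs ! (i - 1) \<le> c"
    have "{..<i} \<subseteq> {j. j < k \<and> xs ! j \<le> c}"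
    proof
      fix j assume "j \<in> {..<i}"
      then have "j \<le> i - 1" "i - 1 < length xs" "j < k" using i len by auto
      with sorted_nth_mono[OF sorted this(1,2)] * show "j \<in> {j. j < k \<and> xs ! j \<le> c}" by simp
    qed
    then have "card {..<i} \<le> card {j. j < k \<and> xs ! j \<le> c}" by (rule card_mono[rotated]) simp
    then show "i \<le> card {j. j < k \<and> xs ! j \<le> c}" by simp
  next
    assume *: "i \<le> card {j. j < k \<and> xs ! j \<le> c}"
    show "xs ! (i - 1) \<le> c"
    proof (rule ccontr)
      assume n: "\<not> xs ! (i - 1) \<le> c"
      have "{j. j < k \<and> xs ! j \<le> c} \<subseteq> {..<i - 1}"
      proof
        fix j assume j: "j \<in> {j. j < k \<and> xs ! j \<le> c}"
        show "j \<in> {..<i - 1}"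
        proof (rule ccontr)
          assume "j \<notin> {..<i - 1}"
          then have "i - 1 \<le> j" "j < length xs" using j len by auto
          with sorted_nth_mono[OF sorted this] j n show False by simp
        qed
      qed
      then have "card {j. j < k \<and> xs ! j \<le> c} \<le> card {..<i - 1}" by (rule card_mono[rotated]) simp
      then have "card {j. j < k \<and> xs ! j \<le> c} \<le> i - 1" by simp
      moreover have "1 \<le> i" using i by simp
      ultimately show False using * by linarith
    qed
  qed
  with card show ?thesis by (simp add: order_stat_def xs_def)
qed

lemma order_stat_measurable:
  assumes i: "i \<in> {1..k}"
  shows "(\<lambda>u. order_stat k u i) \<in> PiM {1..k} (\<lambda>_. unif01) \<rightarrow>\<^sub>M unif01"
proof (subst measurable_unif01_iff, intro conjI ballI)
  let ?P = "PiM {1..k} (\<lambda>_. unif01)"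
  show "(\<lambda>u. order_stat k u i) \<in> borel_measurable ?P"
  proof (rule borel_measurableI_le)
    fix c
    have "(\<lambda>u. card {m \<in> {1..k}. u m \<le> c}) \<in> ?P \<rightarrow>\<^sub>M count_space UNIV"
    proof (rule measurable_card)
      fix m
      show "{u \<in> space ?P. m \<in> {m \<in> {1..k}. u m \<le> c}} \<in> sets ?P"
      proof (cases "m \<in> {1..k}")
        case True
        have "(\<lambda>u. u m) \<in> borel_measurable ?P"
          using measurable_compose[OF measurable_component_singleton[OF True] id_measurable_unif01] by simp
        then show ?thesis using True by simp
      qed simp
    qed
    then have "Measurable.pred ?P (\<lambda>u. i \<le> card {m \<in> {1..k}. u m \<le> c})"
      by measurable
    then show "{u \<in> space ?P. order_stat k u i \<le> c} \<in> sets ?P"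
      unfolding pred_def order_stat_le_iff[OF i] .
  qed
  fix u assume u: "u \<in> space ?P"
  have "order_stat k u i \<in> set (sort (map u [1..<Suc k]))"
    unfolding order_stat_def using i by (intro nth_mem) (auto simp del: upt_Suc)
  then show "order_stat k u i \<in> {0..1}"
    using u by (auto simp: space_PiM PiE_iff)
qed

lemma luce_p_cong: "(\<And>i. i \<in> {1..k} \<Longrightarrow> x i = y i) \<Longrightarrow> luce_p k x = luce_p k y"
  unfolding luce_p_def by (auto intro!: prod.cong arg_cong2[where f = "(/)"] arg_cong2[where f = "(-)"] sum.cong)

lemma luce_p_nonneg:
  assumes "\<And>i. i \<in> {1..k} \<Longrightarrow> 0 \<le> x i"
  shows "0 \<le> luce_p k x"
  unfolding luce_p_def
proof (intro prod_nonneg ballI divide_nonneg_nonneg)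
  fix i assume i: "i \<in> {1..k}"
  show "0 \<le> x i" using assms i by blast
  have "(\<Sum>j = 1..<i. x j) \<le> (\<Sum>j = 1..k. x j)"
    using assms i by (intro sum_mono2) auto
  then show "0 \<le> (\<Sum>j = 1..k. x j) - (\<Sum>j = 1..<i. x j)" by simp
qed

text \<open>The weights have to be nonnegative because a negative product would be truncated to \<open>0\<close> in the point
  measure.\<close>

lemma measure_Luce:
  assumes "\<pi> \<in> perms k" "\<And>i. i \<in> {1..k} \<Longrightarrow> 0 \<le> \<theta> i"
  shows "measure (Luce k \<theta>) {\<pi>} = luce_p k (\<lambda>i. \<theta> (inv \<pi> i))"
proof -
  have "0 \<le> luce_p k (\<lambda>i. \<theta> (inv \<pi> i))"
    using assms permutes_in_image[OF permutes_inv, of \<pi> "{1..k}"]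
    by (intro luce_p_nonneg) (auto simp: perms_def)
  then show ?thesis
    using assms by (simp add: Luce_def measure_def emeasure_point_measure_finite finite_perms)
qed

context luce_weight
begin

text \<open>The race started at time \<open>0\<close>; all clocks almost surely ring after that time.\<close>

lemma race_law:
  assumes u: "u \<in> space (PiM {1..k} (\<lambda>_. unif01))" and s: "s permutes {1..k}"
  shows "(\<integral>\<^sup>+e. indicator {e. strict_mono_on {1..k} (\<lambda>j. e (s j) / f (u (s j)))} e \<partial>PiM {1..k} (\<lambda>_. expo1)) =
    ennreal (luce_p k (\<lambda>i. f (u (s i))))"
proof -
  define xs where "xs = map s [1..<Suc k]"
  have set: "set xs = {1..k}"
    using permutes_image[OF s] by (simp add: xs_def atLeastLessThanSuc_atLeastAtMost del: upt_Suc)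
  have "distinct xs"
    using permutes_inj[OF s] by (auto simp: xs_def distinct_map intro: inj_on_subset simp del: upt_Suc)
  moreover have fu: "0 < f (u i)" if "i \<in> set xs" for i
    using u that pos[of "u i"] by (auto simp: set space_PiM PiE_iff)
  ultimately have "(\<integral>\<^sup>+e. indicator {e. sorted_wrt (<) (0 # map (\<lambda>i. e i / f (u i)) xs)} e \<partial>PiM (set xs) (\<lambda>_. expo1)) =
      ennreal (exp (- 0 * sum_list (map (\<lambda>i. f (u i)) xs)) *
        (\<Prod>i<length xs. f (u (xs ! i)) / sum_list (map (\<lambda>i. f (u i)) (drop i xs))))"
    by (intro exponential_race) auto
  also have "\<dots> = ennreal (luce_p k (\<lambda>i. f (u (s i))))"
    using luce_p_list[where r = "\<lambda>i. f (u i)" and s = s and k = k] by (simp add: xs_def del: upt_Suc)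
  also have "(\<integral>\<^sup>+e. indicator {e. sorted_wrt (<) (0 # map (\<lambda>i. e i / f (u i)) xs)} e \<partial>PiM (set xs) (\<lambda>_. expo1)) =
      (\<integral>\<^sup>+e. indicator {e. strict_mono_on {1..k} (\<lambda>j. e (s j) / f (u (s j)))} e \<partial>PiM {1..k} (\<lambda>_. expo1))"
    unfolding set
  proof (rule nn_integral_cong_AE)
    have "AE e in expo1. 0 < e"
      using AE_lborel_singleton[of 0] unfolding expo1_def
      by (subst AE_density) (auto simp: AE_restrict_space_iff elim!: eventually_mono
        intro!: measurable_restrict_space1)
    then have "AE e in PiM {1..k} (\<lambda>_. expo1). 0 < e i" if "i \<in> {1..k}" for i
      by (rule AE_PiM_component[OF prob_space_expo1 that])
    then have "AE e in PiM {1..k} (\<lambda>_. expo1). \<forall>i\<in>{1..k}. 0 < e i"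
      by (intro AE_finite_allI) auto
    then show "AE e in PiM {1..k} (\<lambda>_. expo1).
        indicator {e. sorted_wrt (<) (0 # map (\<lambda>i. e i / f (u i)) xs)} e =
        (indicator {e. strict_mono_on {1..k} (\<lambda>j. e (s j) / f (u (s j)))} e :: ennreal)"
    proof eventually_elim
      case (elim e)
      then have "\<forall>i\<in>set xs. 0 < e i / f (u i)"
        using fu by (simp add: set)
      then have "sorted_wrt (<) (0 # map (\<lambda>i. e i / f (u i)) xs) \<longleftrightarrow>
          strict_mono_on {1..k} (\<lambda>j. e (s j) / f (u (s j)))"
        using strict_mono_on_iff_sorted_wrt[of k "\<lambda>i. e i / f (u i)" s] by (simp add: xs_def del: upt_Suc)
      then show ?case by (simp add: indicator_def del: sorted_wrt.simps)
    qed
  qed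
  finally show ?thesis .
qed

text \<open>The point of the square belonging to a label and its unit exponential variable.\<close>

definition permuton_point :: "real \<times> real \<Rightarrow> real \<times> real" where
  "permuton_point z = (fst z, F (snd z / f (fst z)))"

lemma permuton_point_measurable: "permuton_point \<in> unif01 \<Otimes>\<^sub>M expo1 \<rightarrow>\<^sub>M luce_permuton f"
proof -
  have [measurable]: "F \<in> half_line \<rightarrow>\<^sub>M unif01" by (rule F_measurable_half_line)
  note time_measurable [measurable]
  have "permuton_point \<in> unif01 \<Otimes>\<^sub>M expo1 \<rightarrow>\<^sub>M unif01 \<Otimes>\<^sub>M unif01"
    unfolding permuton_point_def by measurable
  moreover have "sets (luce_permuton f) = sets (unif01 \<Otimes>\<^sub>M unif01)"
    by (simp add: luce_permuton_def sets_unif01_pair)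
  ultimately show ?thesis using measurable_cong_sets[OF refl] by blast
qed

lemma luce_permuton_eq_distr_permuton_point: "luce_permuton f = distr (unif01 \<Otimes>\<^sub>M expo1) (luce_permuton f) permuton_point"
  by (subst luce_permuton_def) (auto intro!: distr_cong simp: luce_permuton_def permuton_point_def split_beta')

text \<open>A sample from the permuton can be built from independent labels and clocks, which makes it possible to
  condition on all labels at once.\<close>

lemma PiM_luce_permuton:
  fixes k :: nat
  shows
  "PiM {1..k} (\<lambda>_. luce_permuton f) =
    distr (PiM {1..k} (\<lambda>_. unif01) \<Otimes>\<^sub>M PiM {1..k} (\<lambda>_. expo1)) (PiM {1..k} (\<lambda>_. luce_permuton f))
      (\<lambda>z. \<lambda>i\<in>{1..k}. permuton_point (fst z i, snd z i))"
proof -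
  note permuton_point_measurable [measurable]
  have "PiM {1..k} (\<lambda>_. luce_permuton f) =
      distr (PiM {1..k} (\<lambda>_. unif01 \<Otimes>\<^sub>M expo1)) (PiM {1..k} (\<lambda>_. luce_permuton f)) (compose {1..k} permuton_point)"
    using permuton_luce_permuton
    by (subst distr_PiM_finite_prob_space')
       (auto simp: permuton_def UE.prob_space_axioms permuton_point_measurable luce_permuton_eq_distr_permuton_point[symmetric])
  also have "\<dots> = distr (distr (PiM {1..k} (\<lambda>_. unif01) \<Otimes>\<^sub>M PiM {1..k} (\<lambda>_. expo1)) (PiM {1..k} (\<lambda>_. unif01 \<Otimes>\<^sub>M expo1))
      (\<lambda>z. \<lambda>i\<in>{1..k}. (fst z i, snd z i))) (PiM {1..k} (\<lambda>_. luce_permuton f)) (compose {1..k} permuton_point)"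
    by (subst PiM_pair_measure) (auto simp: prob_space_unif01 prob_space_expo1)
  also have "\<dots> = distr (PiM {1..k} (\<lambda>_. unif01) \<Otimes>\<^sub>M PiM {1..k} (\<lambda>_. expo1)) (PiM {1..k} (\<lambda>_. luce_permuton f))
      (compose {1..k} permuton_point \<circ> (\<lambda>z. \<lambda>i\<in>{1..k}. (fst z i, snd z i)))"
    unfolding compose_def by (rule distr_distr) measurable
  also have "compose {1..k} permuton_point \<circ> (\<lambda>z. \<lambda>i\<in>{1..k}. (fst z i, snd z i)) =
      (\<lambda>z. \<lambda>i\<in>{1..k}. permuton_point (fst z i, snd z i))"
    by (auto simp: compose_def fun_eq_iff)
  finally show ?thesis .
qed

lemma emeasure_expo1_singleton: "emeasure expo1 {e \<in> space expo1. e = c} = 0"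
proof -
  have [measurable]: "(indicator {c} :: real \<Rightarrow> ennreal) \<in> borel_measurable expo1"
    by (rule measurable_compose[OF id_measurable_expo1]) simp
  have "emeasure expo1 {e \<in> space expo1. e = c} = (\<integral>\<^sup>+e. indicator {c} e \<partial>expo1)"
    by (subst nn_integral_indicator[symmetric]) (measurable, auto intro!: nn_integral_cong simp: indicator_def)
  also have "\<dots> = (\<integral>\<^sup>+e. indicator {c} e * ennreal (exp (- e)) * indicator {0..} e \<partial>lborel)"
    by (rule nn_integral_expo1) measurable
  also have "\<dots> = (\<integral>\<^sup>+e. 0 \<partial>(lborel :: real measure))"
    by (rule nn_integral_cong_AE) (use AE_lborel_singleton[of c] in eventually_elim, simp)
  finally show ?thesis by simp
qed

text \<open>Integrate out the clocks for fixed labels. For distinct labels, sorted by \<open>\<tau>\<close>, the pattern occurs if and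
  only if the clocks ring in the order \<open>\<tau> \<circ> inv \<pi>\<close>, and the label in position \<open>i\<close> from the left is the
  \<open>i\<close>-th order statistic.\<close>

lemma occ_luce_permuton:
  assumes \<pi>: "\<pi> \<in> perms k"
  shows "occ k \<pi> (luce_permuton f) =
    (\<integral>u. measure (Luce k (\<lambda>i. f (order_stat k u i))) {\<pi>} \<partial>PiM {1..k} (\<lambda>_. unif01))"
proof -
  let ?U = "PiM {1..k} (\<lambda>_. unif01)" and ?E = "PiM {1..k} (\<lambda>_. expo1)" and ?\<mu> = "luce_permuton f"
  let ?z = "\<lambda>u e. \<lambda>i\<in>{1..k}. permuton_point (u i, e i)"
  let ?A = "perm_of_points k -` {\<pi>} \<inter> space (PiM {1..k} (\<lambda>_. ?\<mu>))"
  let ?R = "\<lambda>u. measure (Luce k (\<lambda>i. f (order_stat k u i))) {\<pi>}"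
  have \<pi>': "\<pi> permutes {1..k}" using \<pi> by (simp add: perms_def)
  have E: "sigma_finite_measure ?E"
    by (intro prob_space_imp_sigma_finite prob_space_PiM prob_space_expo1)
  have sets: "sets ?\<mu> = sets (unif01 \<Otimes>\<^sub>M unif01)"
    by (simp add: luce_permuton_def sets_unif01_pair)
  have [measurable]: "fst \<in> borel_measurable ?\<mu>" "snd \<in> borel_measurable ?\<mu>"
    by (simp_all add: measurable_cong_sets[OF sets refl])
  have pm: "perm_of_points k \<in> PiM {1..k} (\<lambda>_. ?\<mu>) \<rightarrow>\<^sub>M count_space (perms k)"
    by (rule perm_of_points_measurable) measurable
  then have A: "?A \<in> sets (PiM {1..k} (\<lambda>_. ?\<mu>))"
    using \<pi> by (intro measurable_sets[OF pm]) auto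
  note permuton_point_measurable [measurable]
  have zm: "(\<lambda>z. ?z (fst z) (snd z)) \<in> ?U \<Otimes>\<^sub>M ?E \<rightarrow>\<^sub>M PiM {1..k} (\<lambda>_. ?\<mu>)"
    by measurable
  have order: "order_stat k u i \<in> {0..1}" if "u \<in> space ?U" "i \<in> {1..k}" for u i
    using measurable_space[OF order_stat_measurable[OF that(2)] that(1)] by simp
  have inv: "inv \<pi> i \<in> {1..k}" if "i \<in> {1..k}" for i
    using permutes_in_image[OF permutes_inv[OF \<pi>']] that by blast
  have R: "?R u = luce_p k (\<lambda>i. f (order_stat k u (inv \<pi> i)))" if "u \<in> space ?U" for u
    by (rule measure_Luce[OF \<pi>]) (auto intro!: less_imp_le[OF pos] order[OF that])
  \<comment> \<open>Without measurability of the integrand, the integral on the right would be \<open>0\<close> by convention.\<close>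
  have Rm: "?R \<in> borel_measurable ?U"
  proof -
    have "(\<lambda>u. f (order_stat k u (inv \<pi> i))) \<in> borel_measurable ?U" if "i \<in> {1..k}" for i
      by (rule measurable_compose[OF order_stat_measurable[OF inv[OF that]] f_measurable])
    then have "(\<lambda>u. luce_p k (\<lambda>i. f (order_stat k u (inv \<pi> i)))) \<in> borel_measurable ?U"
      unfolding luce_p_def by (intro borel_measurable_prod borel_measurable_divide borel_measurable_diff
          borel_measurable_sum) auto
    then show ?thesis by (rule measurable_cong[THEN iffD1, rotated]) (simp add: R)
  qed
  have inner: "(\<integral>\<^sup>+e. indicator ?A (?z u e) \<partial>?E) = ennreal (?R u)"
    if u: "u \<in> space ?U" and inj: "inj_on u {1..k}" for u
  proof -
    have u01: "u i \<in> {0..1}" if "i \<in> {1..k}" for i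
      using u that by (auto simp: space_PiM PiE_iff)
    obtain \<tau> where \<tau>: "\<tau> permutes {1..k}" "strict_mono_on {1..k} (\<lambda>i. u (\<tau> i))"
      using sorting_permutation[OF inj] .
    define s where "s = \<tau> \<circ> inv \<pi>"
    have s: "s permutes {1..k}"
      unfolding s_def by (intro permutes_compose permutes_inv \<pi>' \<tau>)
    \<comment> \<open>Simultaneous rings would trigger the dummy value of the sampled permutation.\<close>
    have "AE e in ?E. inj_on (\<lambda>i. e i / f (u i)) {1..k}"
    proof (rule AE_PiM_inj_on)
      fix i c assume "i \<in> {1..k}"
      then have "0 < f (u i)" by (intro pos u01)
      then have "{y \<in> space expo1. y / f (u i) = c} = {y \<in> space expo1. y = c * f (u i)}"
        by (auto simp: divide_eq_eq)
      then show "emeasure expo1 {y \<in> space expo1. y / f (u i) = c} = 0"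
        using emeasure_expo1_singleton by simp
    qed (auto simp: prob_space_expo1)
    then have "AE e in ?E. indicator ?A (?z u e) =
        (indicator {e. strict_mono_on {1..k} (\<lambda>j. e (s j) / f (u (s j)))} e :: ennreal)"
      using AE_space
    proof eventually_elim
      case (elim e)
      have t: "0 \<le> e i / f (u i)" if "i \<in> {1..k}" for i
        using elim(2) that pos[OF u01] by (auto simp: space_PiM PiE_iff intro!: divide_nonneg_pos)
      have z: "fst (?z u e i) = u i" "snd (?z u e i) = F (e i / f (u i))" if "i \<in> {1..k}" for i
        using that by (simp_all add: permuton_point_def)
      have "inj_on (\<lambda>m. snd (?z u e m)) {1..k}"
        using elim(1) z(2) F_inj_on t unfolding inj_on_def by (metis atLeast_iff)
      moreover have "strict_mono_on {1..k} (\<lambda>i. fst (?z u e (\<tau> i)))"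
        using \<tau>(2) z(1) permutes_in_image[OF \<tau>(1)] by (simp add: strict_mono_on_def del: restrict_apply)
      ultimately have "perm_of_points k (?z u e) = \<pi> \<longleftrightarrow> strict_mono_on {1..k} (\<lambda>j. snd (?z u e (s j)))"
        using perm_of_points_eq_iff_chain[OF \<tau>(1) _ _ \<pi>, of "?z u e"] by (simp add: s_def del: restrict_apply)
      also have "\<dots> \<longleftrightarrow> strict_mono_on {1..k} (\<lambda>j. e (s j) / f (u (s j)))"
        using z(2) permutes_in_image[OF s] t
        by (simp add: strict_mono_on_def F_less_iff del: restrict_apply)
      finally have iff: "perm_of_points k (?z u e) = \<pi> \<longleftrightarrow> strict_mono_on {1..k} (\<lambda>j. e (s j) / f (u (s j)))" .
      have "?z u e \<in> space (PiM {1..k} (\<lambda>_. ?\<mu>))"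
        using measurable_space[OF zm, of "(u, e)"] u elim(2) by (simp add: space_pair_measure)
      with iff show ?case by (simp add: indicator_def)
    qed
    then have "(\<integral>\<^sup>+e. indicator ?A (?z u e) \<partial>?E) =
        (\<integral>\<^sup>+e. indicator {e. strict_mono_on {1..k} (\<lambda>j. e (s j) / f (u (s j)))} e \<partial>?E)"
      by (rule nn_integral_cong_AE)
    also have "\<dots> = ennreal (luce_p k (\<lambda>i. f (u (s i))))"
      by (rule race_law[OF u s])
    also have "luce_p k (\<lambda>i. f (u (s i))) = ?R u"
      unfolding R[OF u]
    proof (rule luce_p_cong)
      fix i assume i: "i \<in> {1..k}"
      show "f (u (s i)) = f (order_stat k u (inv \<pi> i))"
        by (simp only: s_def o_def order_stat_eq[OF \<tau> inv[OF i]])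
    qed
    finally show ?thesis .
  qed
  have "emeasure (Perm ?\<mu> k) {\<pi>} = emeasure (PiM {1..k} (\<lambda>_. ?\<mu>)) ?A"
    unfolding Perm_def using \<pi> by (intro emeasure_distr[OF pm]) auto
  also have "\<dots> = (\<integral>\<^sup>+z. indicator ?A z \<partial>PiM {1..k} (\<lambda>_. ?\<mu>))"
    using A by simp
  also have "\<dots> = (\<integral>\<^sup>+z. indicator ?A (?z (fst z) (snd z)) \<partial>(?U \<Otimes>\<^sub>M ?E))"
    by (subst PiM_luce_permuton, subst nn_integral_distr[OF zm]) (use A in simp_all)
  also have "\<dots> = (\<integral>\<^sup>+u. (\<integral>\<^sup>+e. indicator ?A (?z u e) \<partial>?E) \<partial>?U)"
    using A by (subst sigma_finite_measure.nn_integral_fst[OF E, symmetric])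
      (auto intro!: measurable_compose[OF zm])
  also have "\<dots> = (\<integral>\<^sup>+u. ennreal (?R u) \<partial>?U)"
  proof (rule nn_integral_cong_AE)
    have "AE u in ?U. inj_on (\<lambda>i. u i) {1..k}"
    proof (rule AE_PiM_inj_on)
      fix c
      have "{y \<in> space unif01. y = c} \<subseteq> {c}" by auto
      then have "{y \<in> space unif01. y = c} = {} \<or> {y \<in> space unif01. y = c} = {c}" by auto
      then show "emeasure unif01 {y \<in> space unif01. y = c} = 0"
        using emeasure_unif01_singleton by (metis emeasure_empty)
    qed (auto simp: prob_space_unif01)
    then show "AE u in ?U. (\<integral>\<^sup>+e. indicator ?A (?z u e) \<partial>?E) = ennreal (?R u)"
      using AE_space by eventually_elim (rule inner)
  qed
  finally have "occ k \<pi> ?\<mu> = enn2real (\<integral>\<^sup>+u. ennreal (?R u) \<partial>?U)"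
    by (simp add: occ_def measure_def)
  also have "\<dots> = (\<integral>u. ?R u \<partial>?U)"
    by (rule integral_eq_nn_integral[symmetric, OF Rm]) simp
  finally show ?thesis .
qed

end

section \<open>Pattern densities determine the moments of a permuton\<close>

lemma sets_permuton: "permuton \<nu> \<Longrightarrow> sets \<nu> = sets (unif01 \<Otimes>\<^sub>M unif01)"
  by (simp add: permuton_def sets_unif01_pair)

lemma space_permuton: "permuton \<nu> \<Longrightarrow> space \<nu> = square"
  by (simp add: sets_eq_imp_space_eq[OF sets_permuton] space_pair_measure)

lemma permuton_coordinate_measurable:
  assumes "permuton \<nu>" shows "fst \<in> \<nu> \<rightarrow>\<^sub>M unif01" "snd \<in> \<nu> \<rightarrow>\<^sub>M unif01"
  by (simp_all add: measurable_cong_sets[OF sets_permuton[OF assms] refl])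

text \<open>This is where uniformity of the marginals enters: a coordinate of one point of the sample is the
  probability that another point stays below it.\<close>

lemma permuton_marginal_atMost:
  assumes \<nu>: "permuton \<nu>" and c: "c \<in> {0..1}"
  shows "(\<integral>\<^sup>+w. indicator {w. fst w \<le> c} w \<partial>\<nu>) = ennreal c"
    and "(\<integral>\<^sup>+w. indicator {w. snd w \<le> c} w \<partial>\<nu>) = ennreal c"
proof -
  have *: "(\<integral>\<^sup>+w. indicator {w. p w \<le> c} w \<partial>\<nu>) = ennreal c"
    if p: "p \<in> \<nu> \<rightarrow>\<^sub>M unif01" and d: "distr \<nu> unif01 p = unif01" for p :: "real \<times> real \<Rightarrow> real"
  proof -
    have s: "{0..c} \<in> sets unif01" using c by (auto simp: unif01_sets_iff)
    have "(\<integral>\<^sup>+w. indicator {w. p w \<le> c} w \<partial>\<nu>) = (\<integral>\<^sup>+w. indicator {0..c} (p w) \<partial>\<nu>)"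
      using measurable_space[OF p] by (intro nn_integral_cong) (auto simp: indicator_def)
    also have "\<dots> = (\<integral>\<^sup>+x. indicator {0..c} x \<partial>distr \<nu> unif01 p)"
      using s by (subst nn_integral_distr[OF p]) auto
    also have "\<dots> = ennreal c"
      using s c by (simp add: d emeasure_unif01_atMost)
    finally show ?thesis .
  qed
  show "(\<integral>\<^sup>+w. indicator {w. fst w \<le> c} w \<partial>\<nu>) = ennreal c"
    "(\<integral>\<^sup>+w. indicator {w. snd w \<le> c} w \<partial>\<nu>) = ennreal c"
    using * permuton_coordinate_measurable[OF \<nu>] \<nu> by (auto simp: permuton_def)
qed

lemma permuton_AE_no_ties:
  fixes k :: nat
  assumes \<nu>: "permuton \<nu>"
  shows "AE z in PiM {1..k} (\<lambda>_. \<nu>). inj_on (\<lambda>m. fst (z m)) {1..k} \<and> inj_on (\<lambda>m. snd (z m)) {1..k}"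
proof -
  have *: "AE z in PiM {1..k} (\<lambda>_. \<nu>). inj_on (\<lambda>m. p (z m)) {1..k}"
    if p: "p \<in> \<nu> \<rightarrow>\<^sub>M unif01" and d: "distr \<nu> unif01 p = unif01" for p :: "real \<times> real \<Rightarrow> real"
  proof (rule AE_PiM_inj_on)
    fix c
    have pb: "p \<in> borel_measurable \<nu>" using p by (simp add: measurable_unif01_iff)
    then show "p \<in> borel_measurable \<nu>" .
    show "emeasure \<nu> {w \<in> space \<nu>. p w = c} = 0"
    proof (cases "c \<in> {0..1}")
      case True
      then have "emeasure (distr \<nu> unif01 p) {c} = emeasure \<nu> (p -` {c} \<inter> space \<nu>)"
        by (intro emeasure_distr[OF p]) (auto simp: unif01_sets_iff)
      moreover have "p -` {c} \<inter> space \<nu> = {w \<in> space \<nu>. p w = c}" by auto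
      ultimately show ?thesis by (simp add: d emeasure_unif01_singleton)
    next
      case False
      then have e: "{w \<in> space \<nu>. p w = c} = {}"
        using measurable_space[OF p] by auto
      show ?thesis unfolding e by simp
    qed
  qed (use \<nu> in \<open>auto simp: permuton_def\<close>)
  show ?thesis
    using *[OF permuton_coordinate_measurable(1)[OF \<nu>]] *[OF permuton_coordinate_measurable(2)[OF \<nu>]] \<nu>
    by (simp add: permuton_def)
qed

text \<open>The last of the points \<open>z 1, \<dots>, z (a + b + 1)\<close> lies weakly to the right of the first \<open>a\<close> ones and
  weakly above the following \<open>b\<close> ones. The types of the coordinates are left open so that the notion also applies to ranks.\<close>

definition dominates :: "nat \<Rightarrow> nat \<Rightarrow> (nat \<Rightarrow> 'a::linorder \<times> 'b::linorder) \<Rightarrow> bool" where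
  "dominates a b z \<longleftrightarrow>
    (\<forall>i\<in>{1..a}. fst (z i) \<le> fst (z (Suc (a + b)))) \<and>
    (\<forall>i\<in>{Suc a..a + b}. snd (z i) \<le> snd (z (Suc (a + b))))"

text \<open>The number of ways to label the points of the diagram of \<open>\<pi>\<close> such that the event above occurs.\<close>

definition dominating_labellings :: "nat \<Rightarrow> nat \<Rightarrow> (nat \<Rightarrow> nat) \<Rightarrow> nat" where
  "dominating_labellings a b \<pi> = card {\<rho> \<in> perms (Suc (a + b)). dominates a b (\<lambda>i. (\<rho> i, \<pi> (\<rho> i)))}"

text \<open>Whether a relabelled sample satisfies the event depends on the ranks of its coordinates only. Labelling
  the points from left to right replaces the sample by the diagram of its permutation, and composing with
  this labelling permutes the relabellings.\<close>

lemma card_dominates: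
  fixes z :: "nat \<Rightarrow> real \<times> real"
  assumes k: "k = Suc (a + b)"
    and x: "inj_on (\<lambda>m. fst (z m)) {1..k}" and y: "inj_on (\<lambda>m. snd (z m)) {1..k}"
  shows "card {\<sigma> \<in> perms k. dominates a b (\<lambda>i. z (\<sigma> i))} = dominating_labellings a b (perm_of_points k z)"
proof -
  let ?\<pi> = "perm_of_points k z"
  obtain \<tau> where \<tau>: "\<tau> permutes {1..k}" "strict_mono_on {1..k} (\<lambda>i. fst (z (\<tau> i)))"
    using sorting_permutation[OF x] .
  have rx: "rank k (\<lambda>m. fst (z m)) (\<tau> i) = i" if "i \<in> {1..k}" for i
    using rank_strict_mono[OF \<tau>(1), of "\<lambda>m. fst (z m)"] \<tau>(2) that by simp
  have \<tau>k: "\<tau> i \<in> {1..k}" if "i \<in> {1..k}" for i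
    using permutes_in_image[OF \<tau>(1)] that by simp
  have ry: "rank k (\<lambda>m. snd (z m)) (\<tau> i) = ?\<pi> i" if "i \<in> {1..k}" for i
    using perm_of_points_rank[OF x y \<tau>k[OF that]] rx[OF that] by simp
  have lex: "fst (z (\<tau> i)) \<le> fst (z (\<tau> j)) \<longleftrightarrow> i \<le> j" if "i \<in> {1..k}" "j \<in> {1..k}" for i j
    using rank_le_iff[OF \<tau>k[OF that(1)] \<tau>k[OF that(2)], of "\<lambda>m. fst (z m)"] rx that by simp
  have ley: "snd (z (\<tau> i)) \<le> snd (z (\<tau> j)) \<longleftrightarrow> ?\<pi> i \<le> ?\<pi> j" if "i \<in> {1..k}" "j \<in> {1..k}" for i j
    using rank_le_iff[OF \<tau>k[OF that(1)] \<tau>k[OF that(2)], of "\<lambda>m. snd (z m)"] ry that by simp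
  have dom: "dominates a b (\<lambda>i. z (\<tau> (\<rho> i))) \<longleftrightarrow> dominates a b (\<lambda>i. (\<rho> i, ?\<pi> (\<rho> i)))"
    if "\<rho> permutes {1..k}" for \<rho>
  proof -
    have "\<rho> i \<in> {1..k}" if "i \<in> {1..k}" for i
      using permutes_in_image[OF \<open>\<rho> permutes {1..k}\<close>] that by simp
    then show ?thesis
      unfolding dominates_def k[symmetric] fst_conv snd_conv
      by (intro conj_cong ball_cong refl lex ley) (auto simp: k)
  qed
  have "bij_betw (\<lambda>\<rho>. \<tau> \<circ> \<rho>) {\<rho> \<in> perms k. dominates a b (\<lambda>i. (\<rho> i, ?\<pi> (\<rho> i)))}
      {\<sigma> \<in> perms k. dominates a b (\<lambda>i. z (\<sigma> i))}"
  proof (rule bij_betw_byWitness[where f' = "\<lambda>\<sigma>. inv \<tau> \<circ> \<sigma>"])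
    show "\<forall>\<rho>\<in>{\<rho> \<in> perms k. dominates a b (\<lambda>i. (\<rho> i, ?\<pi> (\<rho> i)))}. inv \<tau> \<circ> (\<tau> \<circ> \<rho>) = \<rho>"
      "\<forall>\<sigma>\<in>{\<sigma> \<in> perms k. dominates a b (\<lambda>i. z (\<sigma> i))}. \<tau> \<circ> (inv \<tau> \<circ> \<sigma>) = \<sigma>"
      using permutes_inverses[OF \<tau>(1)] by (simp_all add: fun_eq_iff)
    show "(\<lambda>\<rho>. \<tau> \<circ> \<rho>) ` {\<rho> \<in> perms k. dominates a b (\<lambda>i. (\<rho> i, ?\<pi> (\<rho> i)))}
        \<subseteq> {\<sigma> \<in> perms k. dominates a b (\<lambda>i. z (\<sigma> i))}"
    proof
      fix \<sigma> assume "\<sigma> \<in> (\<lambda>\<rho>. \<tau> \<circ> \<rho>) ` {\<rho> \<in> perms k. dominates a b (\<lambda>i. (\<rho> i, ?\<pi> (\<rho> i)))}"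
      then obtain \<rho> where \<rho>: "\<sigma> = \<tau> \<circ> \<rho>" "\<rho> permutes {1..k}" "dominates a b (\<lambda>i. (\<rho> i, ?\<pi> (\<rho> i)))"
        by (auto simp: perms_def)
      have "\<sigma> permutes {1..k}"
        unfolding \<rho>(1) by (intro permutes_compose \<tau> \<rho>)
      then show "\<sigma> \<in> {\<sigma> \<in> perms k. dominates a b (\<lambda>i. z (\<sigma> i))}"
        using dom[OF \<rho>(2)] \<rho>(1,3) by (simp add: perms_def)
    qed
    show "(\<lambda>\<sigma>. inv \<tau> \<circ> \<sigma>) ` {\<sigma> \<in> perms k. dominates a b (\<lambda>i. z (\<sigma> i))}
        \<subseteq> {\<rho> \<in> perms k. dominates a b (\<lambda>i. (\<rho> i, ?\<pi> (\<rho> i)))}"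
    proof
      fix \<rho> assume "\<rho> \<in> (\<lambda>\<sigma>. inv \<tau> \<circ> \<sigma>) ` {\<sigma> \<in> perms k. dominates a b (\<lambda>i. z (\<sigma> i))}"
      then obtain \<sigma> where \<sigma>: "\<rho> = inv \<tau> \<circ> \<sigma>" "\<sigma> permutes {1..k}" "dominates a b (\<lambda>i. z (\<sigma> i))"
        by (auto simp: perms_def)
      have p: "\<rho> permutes {1..k}"
        unfolding \<sigma>(1) by (intro permutes_compose permutes_inv \<tau> \<sigma>)
      moreover have "\<tau> (\<rho> i) = \<sigma> i" for i
        using permutes_inverses[OF \<tau>(1)] by (simp add: \<sigma>(1))
      ultimately show "\<rho> \<in> {\<rho> \<in> perms k. dominates a b (\<lambda>i. (\<rho> i, ?\<pi> (\<rho> i)))}"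
        using dom[OF p] \<sigma>(3) by (simp add: perms_def)
    qed
  qed
  from bij_betw_same_card[OF this] show ?thesis
    by (simp add: dominating_labellings_def k)
qed

lemma dominates_measurable:
  assumes \<nu>: "permuton \<nu>" and k: "k = Suc (a + b)"
  shows "Measurable.pred (PiM {1..k} (\<lambda>_. \<nu>)) (dominates a b)"
proof -
  let ?P = "PiM {1..k} (\<lambda>_. \<nu>)"
  have c: "(\<lambda>z. fst (z i)) \<in> borel_measurable ?P" "(\<lambda>z. snd (z i)) \<in> borel_measurable ?P" if "i \<in> {1..k}" for i
    using permuton_coordinate_measurable[OF \<nu>] that
    by (auto simp: measurable_unif01_iff intro!: measurable_compose[OF measurable_component_singleton])
  have "Measurable.pred ?P (\<lambda>z. \<forall>i\<in>{1..a}. fst (z i) \<le> fst (z k))"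
  proof (intro pred_intros_finite)
    fix i assume "i \<in> {1..a}"
    then have "i \<in> {1..k}" "k \<in> {1..k}" using k by auto
    then show "Measurable.pred ?P (\<lambda>z. fst (z i) \<le> fst (z k))"
      unfolding pred_def by (intro borel_measurable_le c)
  qed simp
  moreover have "Measurable.pred ?P (\<lambda>z. \<forall>i\<in>{Suc a..a + b}. snd (z i) \<le> snd (z k))"
  proof (intro pred_intros_finite)
    fix i assume "i \<in> {Suc a..a + b}"
    then have "i \<in> {1..k}" "k \<in> {1..k}" using k by auto
    then show "Measurable.pred ?P (\<lambda>z. snd (z i) \<le> snd (z k))"
      unfolding pred_def by (intro borel_measurable_le c)
  qed simp
  ultimately show ?thesis
    unfolding dominates_def k[symmetric] by (intro pred_intros_logic)
qed

lemma prod_indicator: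
  "finite I \<Longrightarrow> (\<Prod>i\<in>I. indicator (S i) (z i) :: ennreal) = of_bool (\<forall>i\<in>I. z i \<in> S i)"
  by (induction I rule: finite_induct) (auto simp: indicator_def)

text \<open>Given the distinguished point \<open>w\<close>, the \<open>a + b\<close> comparisons are independent, and each has
  probability \<open>fst w\<close> or \<open>snd w\<close>.\<close>

lemma nn_integral_dominates:
  assumes \<nu>: "permuton \<nu>" and k: "k = Suc (a + b)"
  shows "(\<integral>\<^sup>+z. indicator (Collect (dominates a b)) z \<partial>PiM {1..k} (\<lambda>_. \<nu>)) =
    (\<integral>\<^sup>+w. ennreal (fst w ^ a * snd w ^ b) \<partial>\<nu>)"
proof -
  interpret product_prob_space "\<lambda>_. \<nu>"
    by (rule product_prob_spaceI) (use \<nu> in \<open>simp add: permuton_def\<close>)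
  have ins: "{1..k} = insert k {1..a + b}" using k by auto
  have m: "(indicator (Collect (dominates a b)) :: _ \<Rightarrow> ennreal) \<in> borel_measurable (PiM (insert k {1..a + b}) (\<lambda>_. \<nu>))"
    using dominates_measurable[OF \<nu> k] unfolding ins[symmetric] by simp
  let ?g = "\<lambda>w i v. indicator (if i \<le> a then {v. fst v \<le> fst w} else {v. snd v \<le> snd w}) v :: ennreal"
  have "(\<integral>\<^sup>+z. indicator (Collect (dominates a b)) z \<partial>PiM {1..k} (\<lambda>_. \<nu>)) =
      (\<integral>\<^sup>+w. (\<integral>\<^sup>+z. indicator (Collect (dominates a b)) (z(k := w)) \<partial>PiM {1..a + b} (\<lambda>_. \<nu>)) \<partial>\<nu>)"
    unfolding ins by (rule product_nn_integral_insert_rev[OF _ _ m]) (auto simp: k)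
  also have "\<dots> = (\<integral>\<^sup>+w. (\<integral>\<^sup>+z. (\<Prod>i\<in>{1..a + b}. ?g w i (z i)) \<partial>PiM {1..a + b} (\<lambda>_. \<nu>)) \<partial>\<nu>)"
  proof (intro nn_integral_cong)
    fix w :: "real \<times> real" and z :: "nat \<Rightarrow> real \<times> real"
    have "dominates a b (z(k := w)) \<longleftrightarrow>
        (\<forall>i\<in>{1..a + b}. z i \<in> (if i \<le> a then {v. fst v \<le> fst w} else {v. snd v \<le> snd w}))"
    proof -
      have "{1..a + b} = {1..a} \<union> {Suc a..a + b}" by auto
      then show ?thesis by (auto simp: dominates_def k)
    qed
    then show "indicator (Collect (dominates a b)) (z(k := w)) = (\<Prod>i\<in>{1..a + b}. ?g w i (z i))"
      by (simp only: prod_indicator finite_atLeastAtMost) (simp add: indicator_def)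
  qed
  also have "\<dots> = (\<integral>\<^sup>+w. ennreal (fst w ^ a * snd w ^ b) \<partial>\<nu>)"
  proof (rule nn_integral_cong)
    fix w assume "w \<in> space \<nu>"
    then have w: "fst w \<in> {0..1}" "snd w \<in> {0..1}"
      by (auto simp: space_permuton[OF \<nu>])
    have "(\<integral>\<^sup>+z. (\<Prod>i\<in>{1..a + b}. ?g w i (z i)) \<partial>PiM {1..a + b} (\<lambda>_. \<nu>)) =
        (\<Prod>i\<in>{1..a + b}. \<integral>\<^sup>+v. ?g w i v \<partial>\<nu>)"
    proof (rule product_nn_integral_prod)
      fix i
      have [measurable]: "fst \<in> borel_measurable \<nu>" "snd \<in> borel_measurable \<nu>"
        using permuton_coordinate_measurable[OF \<nu>] by (auto simp: measurable_unif01_iff)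
      show "?g w i \<in> borel_measurable \<nu>" by (cases "i \<le> a") (simp_all, measurable)
    qed simp
    also have "\<dots> = (\<Prod>i\<in>{1..a + b}. ennreal (if i \<le> a then fst w else snd w))"
      using permuton_marginal_atMost[OF \<nu>] w by (intro prod.cong) auto
    also have "\<dots> = (\<Prod>i\<in>{1..a}. ennreal (fst w)) * (\<Prod>i\<in>{Suc a..a + b}. ennreal (snd w))"
    proof -
      have "{1..a + b} = {1..a} \<union> {Suc a..a + b}" by auto
      then show ?thesis by (simp add: prod.union_disjoint)
    qed
    also have "\<dots> = ennreal (fst w ^ a * snd w ^ b)"
      using w by (simp add: ennreal_power ennreal_mult)
    finally show "(\<integral>\<^sup>+z. (\<Prod>i\<in>{1..a + b}. ?g w i (z i)) \<partial>PiM {1..a + b} (\<lambda>_. \<nu>)) =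
        ennreal (fst w ^ a * snd w ^ b)" .
  qed
  finally show ?thesis .
qed

text \<open>All relabellings of the sample have the same law, so \<open>fact k\<close> times the probability of the event is the
  expected number of relabellings for which it occurs; by the count above this number is a function of the
  sampled permutation.\<close>

theorem moment_eq_pattern_densities:
  assumes \<nu>: "permuton \<nu>" and k: "k = Suc (a + b)"
  shows "of_nat (fact k) * (\<integral>\<^sup>+w. ennreal (fst w ^ a * snd w ^ b) \<partial>\<nu>) =
    (\<Sum>\<pi>\<in>perms k. ennreal (occ k \<pi> \<nu>) * of_nat (dominating_labellings a b \<pi>))"
proof -
  let ?P = "PiM {1..k} (\<lambda>_. \<nu>)" and ?D = "Collect (dominates a b)"
  have prob: "prob_space \<nu>" using \<nu> by (simp add: permuton_def)
  interpret P: prob_space ?P by (rule prob_space_PiM) (rule prob)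
  have Dm: "(indicator ?D :: _ \<Rightarrow> ennreal) \<in> borel_measurable ?P"
    using dominates_measurable[OF \<nu> k] by simp
  have relabel: "(\<lambda>z. \<lambda>i\<in>{1..k}. z (\<sigma> i)) \<in> ?P \<rightarrow>\<^sub>M ?P" if "\<sigma> \<in> perms k" for \<sigma>
    using that by (intro measurable_restrict measurable_component_singleton)
      (auto simp: perms_def dest: permutes_in_image simp del: atLeastAtMost_iff)
  have D_relabel: "indicator ?D (\<lambda>i\<in>{1..k}. z (\<sigma> i)) = indicator ?D (\<lambda>i. z (\<sigma> i))" for z :: "nat \<Rightarrow> real \<times> real" and \<sigma>
    by (simp add: indicator_def dominates_def k)
  have exch: "(\<integral>\<^sup>+z. indicator ?D (\<lambda>i. z (\<sigma> i)) \<partial>?P) = (\<integral>\<^sup>+z. indicator ?D z \<partial>?P)" if \<sigma>: "\<sigma> \<in> perms k" for \<sigma>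
  proof -
    have "distr ?P ?P (\<lambda>z. \<lambda>i\<in>{1..k}. z (\<sigma> i)) = ?P"
      using \<sigma> prob by (intro distr_PiM_reindex)
        (auto simp: perms_def permutes_inj_on permutes_in_image simp del: atLeastAtMost_iff)
    then have "(\<integral>\<^sup>+z. indicator ?D z \<partial>?P) = (\<integral>\<^sup>+z. indicator ?D z \<partial>distr ?P ?P (\<lambda>z. \<lambda>i\<in>{1..k}. z (\<sigma> i)))"
      by simp
    also have "\<dots> = (\<integral>\<^sup>+z. indicator ?D (\<lambda>i\<in>{1..k}. z (\<sigma> i)) \<partial>?P)"
      by (rule nn_integral_distr[OF relabel[OF \<sigma>]]) (use Dm in simp)
    finally show ?thesis by (simp only: D_relabel)
  qed
  have pm: "perm_of_points k \<in> ?P \<rightarrow>\<^sub>M count_space (perms k)"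
    using permuton_coordinate_measurable[OF \<nu>]
    by (intro perm_of_points_measurable) (auto simp: measurable_unif01_iff)
  have "of_nat (fact k) * (\<integral>\<^sup>+w. ennreal (fst w ^ a * snd w ^ b) \<partial>\<nu>) = 
      (\<Sum>\<sigma>\<in>perms k. \<integral>\<^sup>+z. indicator ?D (\<lambda>i. z (\<sigma> i)) \<partial>?P)"
  proof -
    have "card (perms k) = fact k" by (simp add: perms_def card_permutations)
    moreover have "(\<Sum>\<sigma>\<in>perms k. \<integral>\<^sup>+z. indicator ?D (\<lambda>i. z (\<sigma> i)) \<partial>?P) =
        (\<Sum>\<sigma>\<in>perms k. \<integral>\<^sup>+z. indicator ?D z \<partial>?P)"
      by (rule sum.cong[OF refl exch])
    ultimately show ?thesis
      unfolding nn_integral_dominates[OF \<nu> k] by simp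
  qed
  also have "\<dots> = (\<integral>\<^sup>+z. (\<Sum>\<sigma>\<in>perms k. indicator ?D (\<lambda>i. z (\<sigma> i))) \<partial>?P)"
  proof (rule nn_integral_sum[symmetric])
    fix \<sigma> assume \<sigma>: "\<sigma> \<in> perms k"
    show "(\<lambda>z. indicator ?D (\<lambda>i. z (\<sigma> i)) :: ennreal) \<in> borel_measurable ?P"
      using measurable_compose[OF relabel[OF \<sigma>] Dm] by (simp only: D_relabel)
  qed
  also have "\<dots> = (\<integral>\<^sup>+z. (\<Sum>\<pi>\<in>perms k. indicator (perm_of_points k -` {\<pi>} \<inter> space ?P) z * of_nat (dominating_labellings a b \<pi>)) \<partial>?P)"
  proof (rule nn_integral_cong_AE)
    show "AE z in ?P. (\<Sum>\<sigma>\<in>perms k. indicator ?D (\<lambda>i. z (\<sigma> i)) :: ennreal) =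
        (\<Sum>\<pi>\<in>perms k. indicator (perm_of_points k -` {\<pi>} \<inter> space ?P) z * of_nat (dominating_labellings a b \<pi>))"
      using permuton_AE_no_ties[OF \<nu>, of k] AE_space
    proof eventually_elim
      case (elim z)
      have "(\<Sum>\<sigma>\<in>perms k. indicator ?D (\<lambda>i. z (\<sigma> i)) :: ennreal) =
          of_nat (card {\<sigma> \<in> perms k. dominates a b (\<lambda>i. z (\<sigma> i))})"
        by (simp add: indicator_def of_bool_def sum.If_cases finite_perms Int_def)
      also have "\<dots> = of_nat (dominating_labellings a b (perm_of_points k z))"
        using elim card_dominates[OF k] by simp
      also have "\<dots> = (\<Sum>\<pi>\<in>perms k. if perm_of_points k z = \<pi> then of_nat (dominating_labellings a b \<pi>) else 0)"
        by (simp add: finite_perms perm_of_points_in_perms)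
      also have "\<dots> = (\<Sum>\<pi>\<in>perms k. indicator (perm_of_points k -` {\<pi>} \<inter> space ?P) z * of_nat (dominating_labellings a b \<pi>))"
        using elim(2) by (intro sum.cong) (auto simp: indicator_def)
      finally show ?case .
    qed
  qed
  also have "\<dots> = (\<Sum>\<pi>\<in>perms k. emeasure ?P (perm_of_points k -` {\<pi>} \<inter> space ?P) * of_nat (dominating_labellings a b \<pi>))"
    using measurable_sets[OF pm] by (subst nn_integral_sum) (auto simp: nn_integral_multc)
  also have "\<dots> = (\<Sum>\<pi>\<in>perms k. ennreal (occ k \<pi> \<nu>) * of_nat (dominating_labellings a b \<pi>))"
  proof (intro sum.cong refl)
    fix \<pi> assume "\<pi> \<in> perms k"
    then have "occ k \<pi> \<nu> = measure ?P (perm_of_points k -` {\<pi>} \<inter> space ?P)"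
      unfolding occ_def Perm_def by (intro measure_distr[OF pm]) auto
    then show "emeasure ?P (perm_of_points k -` {\<pi>} \<inter> space ?P) * of_nat (dominating_labellings a b \<pi>) =
        ennreal (occ k \<pi> \<nu>) * of_nat (dominating_labellings a b \<pi>)"
      by (simp only: P.emeasure_eq_measure)
  qed
  finally show ?thesis .
qed

section \<open>Moments determine a permuton\<close>

lemma permuton_continuous_integrable:
  fixes g :: "real \<times> real \<Rightarrow> real"
  assumes \<nu>: "permuton \<nu>" and g: "continuous_on square g"
  shows "integrable \<nu> g"
proof -
  interpret prob_space \<nu> using \<nu> by (simp add: permuton_def)
  have "compact (g ` square)"
    by (intro compact_continuous_image[OF g] compact_Times compact_Icc)
  then obtain B where "\<forall>w\<in>square. norm (g w) \<le> B"
    using compact_imp_bounded by (force simp: bounded_iff)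
  moreover have "g \<in> borel_measurable \<nu>"
    using \<nu> borel_measurable_continuous_on_restrict[OF g]
    by (simp add: permuton_def cong: measurable_cong_sets)
  ultimately show ?thesis
    by (intro integrable_const_bound[where B = B] AE_I2) (auto simp: space_permuton[OF \<nu>])
qed

text \<open>Polynomials are uniformly dense in the continuous functions on the square. To avoid expanding a polynomial
  into monomials, consider the functions \<open>g\<close> whose products with all monomials have equal integrals: this
  class is closed under addition, scaling and multiplication by a coordinate, and hence under multiplication
  by any polynomial.\<close>

lemma permuton_integral_eq:
  fixes g :: "real \<times> real \<Rightarrow> real"
  assumes \<nu>: "permuton \<nu>" and \<mu>: "permuton \<mu>"
    and moments: "\<And>a b. (\<integral>w. fst w ^ a * snd w ^ b \<partial>\<nu>) = (\<integral>w. fst w ^ a * snd w ^ b \<partial>\<mu>)"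
    and g: "continuous_on square g"
  shows "(\<integral>w. g w \<partial>\<nu>) = (\<integral>w. g w \<partial>\<mu>)"
proof -
  define S where "S = {g :: real \<times> real \<Rightarrow> real. continuous_on square g \<and>
    (\<forall>a b. (\<integral>w. fst w ^ a * snd w ^ b * g w \<partial>\<nu>) = (\<integral>w. fst w ^ a * snd w ^ b * g w \<partial>\<mu>))}"
  have int: "integrable \<nu> (\<lambda>w. fst w ^ a * snd w ^ b * g w)" "integrable \<mu> (\<lambda>w. fst w ^ a * snd w ^ b * g w)"
    if "continuous_on square g" for a b and g :: "real \<times> real \<Rightarrow> real"
    using that by (auto intro!: permuton_continuous_integrable[OF \<nu>] permuton_continuous_integrable[OF \<mu>] continuous_intros)
  have S_add: "(\<lambda>w. g w + h w) \<in> S" if "g \<in> S" "h \<in> S" for g h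
    using that by (auto simp: S_def distrib_left int intro!: continuous_intros)
  have S_scale: "(\<lambda>w. c * g w) \<in> S" if g: "g \<in> S" for g c
    unfolding S_def
  proof (intro CollectI conjI allI)
    show "continuous_on square (\<lambda>w. c * g w)" using g by (auto simp: S_def intro!: continuous_intros)
    fix a b
    have "fst w ^ a * snd w ^ b * (c * g w) = c * (fst w ^ a * snd w ^ b * g w)" for w
      by (simp add: mult_ac)
    then show "(\<integral>w. fst w ^ a * snd w ^ b * (c * g w) \<partial>\<nu>) = (\<integral>w. fst w ^ a * snd w ^ b * (c * g w) \<partial>\<mu>)"
      using g by (simp only: S_def mem_Collect_eq integral_mult_right_zero)
  qed
  have S_fst: "(\<lambda>w. fst w * g w) \<in> S" if g: "g \<in> S" for g
    unfolding S_def
  proof (intro CollectI conjI allI)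
    show "continuous_on square (\<lambda>w. fst w * g w)" using g by (auto simp: S_def intro!: continuous_intros)
    fix a b
    have "fst w ^ a * snd w ^ b * (fst w * g w) = fst w ^ Suc a * snd w ^ b * g w" for w
      by (simp add: mult_ac)
    then show "(\<integral>w. fst w ^ a * snd w ^ b * (fst w * g w) \<partial>\<nu>) = (\<integral>w. fst w ^ a * snd w ^ b * (fst w * g w) \<partial>\<mu>)"
      using g by (simp only: S_def mem_Collect_eq)
  qed
  have S_snd: "(\<lambda>w. snd w * g w) \<in> S" if g: "g \<in> S" for g
    unfolding S_def
  proof (intro CollectI conjI allI)
    show "continuous_on square (\<lambda>w. snd w * g w)" using g by (auto simp: S_def intro!: continuous_intros)
    fix a b
    have "fst w ^ a * snd w ^ b * (snd w * g w) = fst w ^ a * snd w ^ Suc b * g w" for w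
      by (simp add: mult_ac)
    then show "(\<integral>w. fst w ^ a * snd w ^ b * (snd w * g w) \<partial>\<nu>) = (\<integral>w. fst w ^ a * snd w ^ b * (snd w * g w) \<partial>\<mu>)"
      using g by (simp only: S_def mem_Collect_eq)
  qed
  have S_poly: "(\<lambda>w. h w * g w) \<in> S" if "real_polynomial_function h" "g \<in> S" for g h
    using that
  proof (induction arbitrary: g rule: real_polynomial_function.induct)
    case (linear h)
    then interpret bounded_linear h by blast
    have "h w * g w = h (1, 0) * (fst w * g w) + h (0, 1) * (snd w * g w)" for w
    proof -
      have "w = fst w *\<^sub>R (1, 0) + snd w *\<^sub>R (0, 1)" by (simp add: prod_eq_iff)
      then have "h w = fst w * h (1, 0) + snd w * h (0, 1)" by (metis add scaleR real_scaleR_def)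
      then show ?thesis by (simp add: algebra_simps)
    qed
    then show ?case
      using S_add[OF S_scale[OF S_fst[OF linear.prems]] S_scale[OF S_snd[OF linear.prems]]] by simp
  next
    case (add h1 h2)
    then show ?case using S_add by (simp add: distrib_right)
  next
    case (mult h1 h2)
    then show ?case by (simp add: mult.assoc)
  qed (use S_scale in auto)
  have poly: "(\<integral>w. h w \<partial>\<nu>) = (\<integral>w. h w \<partial>\<mu>)" if "real_polynomial_function h" for h :: "real \<times> real \<Rightarrow> real"
  proof -
    \<comment> \<open>Apply the closure property to the constant \<open>1\<close> and read off the case \<open>a = b = 0\<close>.\<close>
    have "(\<lambda>w. 1) \<in> S" using moments by (auto simp: S_def)
    from S_poly[OF that this] show ?thesis
      unfolding S_def mem_Collect_eq by (auto dest!: conjunct2 spec[where x = 0])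
  qed
  have approx: "\<bar>(\<integral>w. g w \<partial>\<kappa>) - (\<integral>w. h w \<partial>\<kappa>)\<bar> \<le> e"
    if \<kappa>: "permuton \<kappa>" and h: "continuous_on square h" and gh: "\<And>w. w \<in> square \<Longrightarrow> \<bar>g w - h w\<bar> < e"
    for \<kappa> h e
  proof -
    interpret prob_space \<kappa> using \<kappa> by (simp add: permuton_def)
    have ig: "integrable \<kappa> g" "integrable \<kappa> h"
      by (auto intro: permuton_continuous_integrable[OF \<kappa>] g h)
    have "\<bar>(\<integral>w. g w - h w \<partial>\<kappa>)\<bar> \<le> (\<integral>w. \<bar>g w - h w\<bar> \<partial>\<kappa>)"
      by (rule integral_abs_bound)
    also have "\<dots> \<le> (\<integral>w. e \<partial>\<kappa>)"
      using ig gh by (intro integral_mono) (auto simp: space_permuton[OF \<kappa>] intro!: less_imp_le)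
    finally show ?thesis using ig prob_space by simp
  qed
  have "\<bar>(\<integral>w. g w \<partial>\<nu>) - (\<integral>w. g w \<partial>\<mu>)\<bar> \<le> e" if e: "0 < e" for e
  proof -
    have "compact square" by (intro compact_Times compact_Icc)
    then obtain h where h: "real_polynomial_function h" "\<And>w. w \<in> square \<Longrightarrow> \<bar>g w - h w\<bar> < e / 2"
      using Stone_Weierstrass_real_polynomial_function[of square g "e / 2"] g e by auto
    then have hc: "continuous_on square h"
      by (intro continuous_on_polymonial_function) (simp add: real_polynomial_function_eq)
    from approx[OF \<nu> hc h(2)] approx[OF \<mu> hc h(2)] poly[OF h(1)] show ?thesis
      by linarith
  qed
  then have "\<bar>(\<integral>w. g w \<partial>\<nu>) - (\<integral>w. g w \<partial>\<mu>)\<bar> \<le> 0"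
    by (rule field_le_epsilon) simp
  then show ?thesis by simp
qed

text \<open>The indicator of a closed set is a pointwise limit of continuous functions of the distance to the set, and
  the closed sets are a generator of the Borel sets that is stable under intersections.\<close>

lemma permuton_eqI_continuous:
  assumes \<nu>: "permuton \<nu>" and \<mu>: "permuton \<mu>"
    and eq: "\<And>g :: real \<times> real \<Rightarrow> real. continuous_on square g \<Longrightarrow> (\<integral>w. g w \<partial>\<nu>) = (\<integral>w. g w \<partial>\<mu>)"
  shows "\<nu> = \<mu>"
proof -
  let ?id = "\<lambda>w :: real \<times> real. w"
  have id: "?id \<in> borel_measurable \<kappa>" if "permuton \<kappa>" for \<kappa>
    using that measurable_restrict_space1[of ?id borel borel square]
    by (simp add: permuton_def cong: measurable_cong_sets)
  have lim: "(\<lambda>n. \<integral>w. max 0 (1 - real n * infdist w C) \<partial>\<kappa>) \<longlonglongrightarrow> measure \<kappa> (C \<inter> square)"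
    if \<kappa>: "permuton \<kappa>" and C: "closed C" "C \<noteq> {}" for \<kappa> C
  proof -
    interpret prob_space \<kappa> using \<kappa> by (simp add: permuton_def)
    have [measurable]: "?id \<in> borel_measurable \<kappa>" by (rule id[OF \<kappa>])
    have cont: "continuous_on UNIV (\<lambda>w. max 0 (1 - real n * infdist w C))" for n
      by (intro continuous_intros)
    have Cs: "C \<inter> square \<in> sets \<kappa>"
      using \<kappa> C by (auto simp: permuton_def sets_restrict_space)
    have "(\<lambda>n. \<integral>w. max 0 (1 - real n * infdist w C) \<partial>\<kappa>) \<longlonglongrightarrow> (\<integral>w. indicator (C \<inter> square) w \<partial>\<kappa>)"
    proof (rule integral_dominated_convergence[where w = "\<lambda>_. 1"])
      show "AE w in \<kappa>. (\<lambda>n. max 0 (1 - real n * infdist w C)) \<longlonglongrightarrow> indicator (C \<inter> square) w"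
      proof (rule AE_I2)
        fix w assume "w \<in> space \<kappa>"
        then have w: "w \<in> square" by (simp add: space_permuton[OF \<kappa>])
        show "(\<lambda>n. max 0 (1 - real n * infdist w C)) \<longlonglongrightarrow> indicator (C \<inter> square) w"
        proof (cases "w \<in> C")
          case True
          then show ?thesis using w by (simp add: infdist_zero)
        next
          case False
          then have d: "0 < infdist w C" by (rule infdist_pos_not_in_closed[OF C])
          have "\<forall>\<^sub>F n in sequentially. 1 / infdist w C \<le> real n"
            by (rule eventually_sequentiallyI[of "nat \<lceil>1 / infdist w C\<rceil>"]) linarith
          then have "\<forall>\<^sub>F n in sequentially. max 0 (1 - real n * infdist w C) = 0"
            by eventually_elim (use d in \<open>simp add: field_simps\<close>)
          then show ?thesis
            using False by (simp add: tendsto_eventually)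
        qed
      qed
      show "(\<lambda>w. max 0 (1 - real n * infdist w C)) \<in> borel_measurable \<kappa>" for n
        by (rule measurable_compose[OF id[OF \<kappa>] borel_measurable_continuous_onI[OF cont]])
      show "AE w in \<kappa>. norm (max 0 (1 - real n * infdist w C)) \<le> 1" for n
        by (intro AE_I2) (simp add: infdist_nonneg)
    qed (use Cs in auto)
    then show ?thesis using Cs sets.sets_into_space[OF Cs] by (simp add: Int_absorb2)
  qed
  have closed: "emeasure \<nu> (C \<inter> square) = emeasure \<mu> (C \<inter> square)" if C: "closed C" for C
  proof (cases "C = {}")
    case False
    have "(\<integral>w. max 0 (1 - real n * infdist w C) \<partial>\<nu>) = (\<integral>w. max 0 (1 - real n * infdist w C) \<partial>\<mu>)" for n
      by (intro eq continuous_intros)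
    with lim[OF \<nu> C False] lim[OF \<mu> C False] have "measure \<nu> (C \<inter> square) = measure \<mu> (C \<inter> square)"
      by (simp add: LIMSEQ_unique)
    moreover have "emeasure \<kappa> (C \<inter> square) = measure \<kappa> (C \<inter> square)" if "permuton \<kappa>" for \<kappa>
      using that by (simp add: permuton_def prob_space_def finite_measure.emeasure_eq_measure)
    ultimately show ?thesis using \<nu> \<mu> by simp
  qed simp
  have "distr \<nu> borel ?id = distr \<mu> borel ?id"
  proof (rule measure_eqI_generator_eq[where E = "Collect closed" and \<Omega> = UNIV and A = "\<lambda>_. UNIV"])
    show "sets (distr \<nu> borel ?id) = sigma_sets UNIV (Collect closed)"
      "sets (distr \<mu> borel ?id) = sigma_sets UNIV (Collect closed)"
      by (simp_all add: borel_eq_closed)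
    fix C :: "(real \<times> real) set" assume "C \<in> Collect closed"
    then show "emeasure (distr \<nu> borel ?id) C = emeasure (distr \<mu> borel ?id) C"
      using closed[of C] by (simp add: emeasure_distr id \<nu> \<mu> space_permuton)
  next
    show "emeasure (distr \<nu> borel ?id) UNIV \<noteq> \<infinity>"
      using prob_space.emeasure_space_1[of \<nu>] \<nu> by (simp add: emeasure_distr id permuton_def)
  qed (auto simp: Int_stable_def)
  then have *: "emeasure (distr \<nu> borel ?id) A = emeasure (distr \<mu> borel ?id) A" for A
    by simp
  show ?thesis
  proof (rule measure_eqI)
    show "sets \<nu> = sets \<mu>" using \<nu> \<mu> by (simp add: permuton_def)
    fix A assume "A \<in> sets \<nu>"
    then have "A \<in> sets borel" "A \<inter> square = A"
      using \<nu> by (auto simp: permuton_def sets_restrict_space_iff square_borel)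
    with *[of A] show "emeasure \<nu> A = emeasure \<mu> A"
      by (simp add: emeasure_distr id \<nu> \<mu> space_permuton)
  qed
qed

theorem permuton_eqI_pattern_densities:
  assumes \<nu>: "permuton \<nu>" and \<mu>: "permuton \<mu>"
    and occ: "\<And>k \<pi>. 1 \<le> k \<Longrightarrow> \<pi> \<in> perms k \<Longrightarrow> occ k \<pi> \<nu> = occ k \<pi> \<mu>"
  shows "\<nu> = \<mu>"
proof (rule permuton_eqI_continuous[OF \<nu> \<mu>], rule permuton_integral_eq[OF \<nu> \<mu>])
  fix a b
  have moment: "(\<integral>w. fst w ^ a * snd w ^ b \<partial>\<kappa>) = enn2real (\<integral>\<^sup>+w. ennreal (fst w ^ a * snd w ^ b) \<partial>\<kappa>)"
    if \<kappa>: "permuton \<kappa>" for \<kappa>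
  proof (rule integral_eq_nn_integral)
    show "(\<lambda>w. fst w ^ a * snd w ^ b) \<in> borel_measurable \<kappa>"
      by (intro borel_measurable_integrable permuton_continuous_integrable[OF \<kappa>] continuous_intros)
    show "AE w in \<kappa>. 0 \<le> fst w ^ a * snd w ^ b"
      by (intro AE_I2) (auto simp: space_permuton[OF \<kappa>])
  qed
  define k where "k = Suc (a + b)"
  have "(of_nat (fact k) :: ennreal) * (\<integral>\<^sup>+w. ennreal (fst w ^ a * snd w ^ b) \<partial>\<nu>) =
      of_nat (fact k) * (\<integral>\<^sup>+w. ennreal (fst w ^ a * snd w ^ b) \<partial>\<mu>)"
    unfolding moment_eq_pattern_densities[OF \<nu> k_def] moment_eq_pattern_densities[OF \<mu> k_def]
    using occ[of k] by (intro sum.cong) (auto simp: k_def)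
  then have "(\<integral>\<^sup>+w. ennreal (fst w ^ a * snd w ^ b) \<partial>\<nu>) = (\<integral>\<^sup>+w. ennreal (fst w ^ a * snd w ^ b) \<partial>\<mu>)"
    by (subst (asm) ennreal_mult_cancel_left) auto
  then show "(\<integral>w. fst w ^ a * snd w ^ b \<partial>\<nu>) = (\<integral>w. fst w ^ a * snd w ^ b \<partial>\<mu>)"
    by (simp add: moment[OF \<nu>] moment[OF \<mu>])
qed

section \<open>The limiting permuton of the Luce model\<close>

theorem proposition2p2:
  fixes f :: "real \<Rightarrow> real" and \<mu> :: "(real \<times> real) measure"
  assumes meas: "f \<in> borel_measurable (restrict_space borel {0..1})"
    and pos: "\<And>x. x \<in> {0..1} \<Longrightarrow> f x > 0"
    and mu: "\<mu> = luce_permuton f"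
  shows "permuton \<mu> \<and>
    (\<forall>\<nu>. permuton \<nu> \<longrightarrow>
       (\<forall>k\<ge>1. \<forall>\<pi>\<in>perms k. occ k \<pi> \<nu> = occ k \<pi> \<mu>) \<longrightarrow> \<nu> = \<mu>) \<and>
    (\<forall>k\<ge>1. \<forall>\<pi>\<in>perms k.
       occ k \<pi> \<mu> =
         (\<integral>u. measure (Luce k (\<lambda>i. f (order_stat k u i))) {\<pi>} \<partial>Pi\<^sub>M {1..k} (\<lambda>_. unif01))) \<and>
    absolutely_continuous (restrict_space lborel ({0..1} \<times> {0..1})) \<mu> \<and>
    \<mu> = density (restrict_space lborel ({0..1} \<times> {0..1}))
      (\<lambda>(x, y). if (x, y) \<in> {0<..<1} \<times> {0<..<1} then ennreal (luce_density f x y) else 0)"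
proof -
  interpret luce_weight f by unfold_locales (fact meas, fact pos)
  have perm: "permuton \<mu>" unfolding mu by (rule permuton_luce_permuton)
  show ?thesis
  proof (intro conjI allI impI ballI)
    show "permuton \<mu>" by (rule perm)
    show "\<nu> = \<mu>" if "permuton \<nu>" "\<forall>k\<ge>1. \<forall>\<pi>\<in>perms k. occ k \<pi> \<nu> = occ k \<pi> \<mu>" for \<nu>
      using that by (intro permuton_eqI_pattern_densities perm) auto
    show "occ k \<pi> \<mu> = (\<integral>u. measure (Luce k (\<lambda>i. f (order_stat k u i))) {\<pi>} \<partial>Pi\<^sub>M {1..k} (\<lambda>_. unif01))"
      if "\<pi> \<in> perms k" for k \<pi>
      unfolding mu by (rule occ_luce_permuton[OF that])
    show "\<mu> = density (restrict_space lborel square) \<rho>"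
      unfolding mu by (rule luce_permuton_density)
    show "absolutely_continuous (restrict_space lborel square) \<mu>"
      unfolding mu luce_permuton_density
      by (rule absolutely_continuousI_density) (use luce_density_measurable in \<open>simp only: unif01_pair\<close>)
  qed
qed

end
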